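(* Characteristic contraction (from $\mathcal{T}_1^{(2)}$ to $\mathcal{T}_2$) and characteristic subdivision (from $\mathcal{T}_2$ to $\mathcal{T}_1^{(2)}$) preserve the algebraic connectivity and are the inverse of each other. Moreover, let $(T_1,\mathbf{w}_1)\in\mathcal{T}_1^{(2)}$ and let $(T_2,\mathbf{w}_2)$ be its characteristic contraction, where $r$ is the vertex in $V(T_1)\setminus V(T_2)$. Then the following hold. \begin{itemize} \item If $\mathbf{x}_1$ is a Fiedler vector of $(T_1,\mathbf{w}_1)$, then the vector $\mathbf{x}_2$ obtained by removing the $r$-th entry of $\mathbf{x}_1$ is a Fiedler vector of $(T_2,\mathbf{w}_2)$. \item If $\mathbf{x}_2$ is a Fiedler vector of $(T_2,\mathbf{w}_2)$, then the vector $\mathbf{x}_1$ obtained from $\mathbf{x}_2$ by padding a new entry $0$ at position $r$ is a Fiedler vector of $(T_1,\mathbf{w}_1)$. \end{itemize}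
   Context: A weighted tree $(T,\mathbf{w})$ is a tree $T$ with a positive weight $\mathbf{w}(e)$ on each edge $e$; write $\mathbf{w}(i,j)$ for $\mathbf{w}(\{i,j\})$. Its weighted Laplacian matrix has off-diagonal $i,j$-entry $-\mathbf{w}(i,j)$ if $\{i,j\}\in E(T)$, $0$ otherwise, and zero row sums. Its algebraic connectivity is the second smallest eigenvalue of this matrix, and a Fiedler vector is a corresponding eigenvector. It is known that for a Fiedler vector $\mathbf{x}=(x_i)$ of a weighted tree $(T,\mathbf{w})$ exactly one of the following occurs. Type I: some entry of $\mathbf{x}$ is zero; then there is exactly one vertex $i$ with $x_i=0$ adjacent to a vertex $j$ with $x_j\ne0$, and the characteristic set is $\{i\}$. Type II: no entry of $\mathbf{x}$ is zero; then there is exactly one edge $\{i,j\}$ with $x_ix_j<0$, and the characteristic set is $\{i,j\}$. The type and the characteristic set do not depend on the choice of the Fiedler vector. $\mathcal{T}_1^{(2)}$ is the set of Type I weighted trees whose characteristic set consists of a vertex of degree $2$. $\mathcal{T}_2$ is the set of Type II weighted trees. For weighted trees in either set the algebraic connectivity is a simple eigenvalue. Characteristic contraction: let $(T_1,\mathbf{w}_1)\in\mathcal{T}_1^{(2)}$ have characteristic set $\{r\}$, and let $p,q$ be the two neighbors of $r$, $w_p=\mathbf{w}_1(p,r)$, $w_q=\mathbf{w}_1(q,r)$. Let $T_2$ be obtained from $T_1$ by removing $r$ (replacing the edges $\{p,r\}$ and $\{q,r\}$ with the edge $\{p,q\}$), and let $\mathbf{w}_2(p,q)=\frac{w_pw_q}{w_p+w_q}$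 and $\mathbf{w}_2(e)=\mathbf{w}_1(e)$ for all other edges $e$. Then $(T_2,\mathbf{w}_2)$ is the characteristic contraction of $(T_1,\mathbf{w}_1)$. Characteristic subdivision: let $(T_2,\mathbf{w}_2)\in\mathcal{T}_2$ have Fiedler vector $\mathbf{x}=(x_i)$ and characteristic set $\{p,q\}$, and let $w=\mathbf{w}_2(p,q)$. Let $T_1$ be obtained from $T_2$ by subdividing $\{p,q\}$ into $\{p,r\}$ and $\{q,r\}$ with a new vertex $r$, and let $\mathbf{w}_1(p,r)=w\left(1-\frac{x_q}{x_p}\right)$, $\mathbf{w}_1(q,r)=w\left(1-\frac{x_p}{x_q}\right)$, and $\mathbf{w}_1(e)=\mathbf{w}_2(e)$ for all other edges $e$. Then $(T_1,\mathbf{w}_1)$ is the characteristic subdivision of $(T_2,\mathbf{w}_2)$; it does not depend on the choice of $\mathbf{x}$. Being inverse of each other is understood up to the name of the new vertex $r$. *)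

theory Defs
  imports "Jordan_Normal_Form.Char_Poly" "HOL-Library.FuncSet"
begin

section \<open>Weighted trees\<close>

text \<open>
  An edge is a two-element set of vertices. The weight function is taken to be extensional on the
  edge set, so that weighted graphs with the same vertices, edges and edge weights are equal.
\<close>

record 'a wgraph =
  verts :: "'a set"
  edges :: "'a set set"
  wt :: "'a set \<Rightarrow> real"

definition neighbors :: "'a wgraph \<Rightarrow> 'a \<Rightarrow> 'a set" where
  "neighbors G v = {u. {u, v} \<in> edges G}"

definition degree_of :: "'a wgraph \<Rightarrow> 'a \<Rightarrow> nat" where
  "degree_of G v = card (neighbors G v)"

definition simple_graph :: "'a wgraph \<Rightarrow> bool" where
  "simple_graph G \<longleftrightarrow>
     finite (verts G) \<and> (\<forall>e\<in>edges G. \<exists>u\<in>verts G. \<exists>v\<in>verts G. u \<noteq> v \<and> e = {u, v})"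

definition connected_graph :: "'a wgraph \<Rightarrow> bool" where
  "connected_graph G \<longleftrightarrow>
     verts G \<noteq> {} \<and> (\<forall>u\<in>verts G. \<forall>v\<in>verts G. (u, v) \<in> {(a, b). {a, b} \<in> edges G}\<^sup>*)"

definition graph_cycle :: "'a wgraph \<Rightarrow> 'a list \<Rightarrow> bool" where
  "graph_cycle G vs \<longleftrightarrow> 3 \<le> length vs \<and> distinct vs \<and>
     (\<forall>i<length vs. {vs ! i, vs ! (Suc i mod length vs)} \<in> edges G)"

definition weighted_tree :: "'a wgraph \<Rightarrow> bool" where
  "weighted_tree G \<longleftrightarrow>
     simple_graph G \<and> connected_graph G \<and> (\<nexists>vs. graph_cycle G vs) \<and>
     wt G \<in> edges G \<rightarrow>\<^sub>E {0<..}"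

section \<open>Laplacian matrix, algebraic connectivity, Fiedler vectors\<close>

definition laplacian_entry :: "'a wgraph \<Rightarrow> 'a \<Rightarrow> 'a \<Rightarrow> real" where
  "laplacian_entry G i j =
     (if i = j then (\<Sum>k\<in>neighbors G i. wt G {i, k})
      else if {i, j} \<in> edges G then - wt G {i, j} else 0)"

text \<open>
  Matrices and vectors of the library are indexed by natural numbers, so an enumeration of the
  vertices is fixed. The notions below do not depend on it, because another
  enumeration permutes rows and columns simultaneously.
\<close>

definition vertex_list :: "'a wgraph \<Rightarrow> 'a list" where
  "vertex_list G = (SOME vs. distinct vs \<and> set vs = verts G)"

definition laplacian :: "'a wgraph \<Rightarrow> real mat" where
  "laplacian G =
     mat (card (verts G)) (card (verts G))
       (\<lambda>(i, j). laplacian_entry G (vertex_list G ! i) (vertex_list G ! j))"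

definition vec_of :: "'a wgraph \<Rightarrow> ('a \<Rightarrow> real) \<Rightarrow> real vec" where
  "vec_of G x = vec (card (verts G)) (\<lambda>i. x (vertex_list G ! i))"

text \<open>
  Eigenvalues are counted with multiplicity. The list has an entry at position 1 only
  if there are at least two vertices.
\<close>

definition algebraic_connectivity :: "'a wgraph \<Rightarrow> real" where
  "algebraic_connectivity G = sorted_list_of_multiset (proots (char_poly (laplacian G))) ! 1"

text \<open>
  A vector indexed by the vertices is a function that is extensional on the vertex set.
\<close>

definition fiedler_vector :: "'a wgraph \<Rightarrow> ('a \<Rightarrow> real) \<Rightarrow> bool" where
  "fiedler_vector G x \<longleftrightarrow>
     2 \<le> card (verts G) \<and> x \<in> extensional (verts G) \<and>
     eigenvector (laplacian G) (vec_of G x) (algebraic_connectivity G)"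

section \<open>Types and characteristic sets\<close>

definition char_set_of :: "'a wgraph \<Rightarrow> ('a \<Rightarrow> real) \<Rightarrow> 'a set" where
  "char_set_of G x =
     (if \<exists>i\<in>verts G. x i = 0
      then {i\<in>verts G. x i = 0 \<and> (\<exists>j. {i, j} \<in> edges G \<and> x j \<noteq> 0)}
      else {i\<in>verts G. \<exists>j. {i, j} \<in> edges G \<and> x i * x j < 0})"

text \<open>
  The type and the characteristic set of a weighted tree do not depend on the Fiedler vector, so
  they are read off from any one of them.
\<close>

definition type_I :: "'a wgraph \<Rightarrow> bool" where
  "type_I G \<longleftrightarrow> (\<exists>x. fiedler_vector G x \<and> (\<exists>i\<in>verts G. x i = 0))"

definition type_II :: "'a wgraph \<Rightarrow> bool" where
  "type_II G \<longleftrightarrow> (\<exists>x. fiedler_vector G x \<and> (\<forall>i\<in>verts G. x i \<noteq> 0))"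

definition characteristic_set :: "'a wgraph \<Rightarrow> 'a set \<Rightarrow> bool" where
  "characteristic_set G C \<longleftrightarrow> (\<exists>x. fiedler_vector G x \<and> C = char_set_of G x)"

definition T1_2 :: "'a wgraph set" where
  "T1_2 = {G. weighted_tree G \<and> type_I G \<and> (\<exists>r. characteristic_set G {r} \<and> degree_of G r = 2)}"

definition T2 :: "'a wgraph set" where
  "T2 = {G. weighted_tree G \<and> type_II G}"

section \<open>Characteristic contraction and characteristic subdivision\<close>

definition contract :: "'a wgraph \<Rightarrow> 'a \<Rightarrow> 'a \<Rightarrow> 'a \<Rightarrow> 'a wgraph" where
  "contract G p r q =
     (let E = insert {p, q} (edges G - {{p, r}, {q, r}});
          wp = wt G {p, r}; wq = wt G {q, r}
      in \<lparr> verts = verts G - {r}, edges = E,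
           wt = (\<lambda>e\<in>E. if e = {p, q} then wp * wq / (wp + wq) else wt G e) \<rparr>)"

definition subdivide :: "'a wgraph \<Rightarrow> 'a \<Rightarrow> 'a \<Rightarrow> 'a \<Rightarrow> real \<Rightarrow> real \<Rightarrow> 'a wgraph" where
  "subdivide G p r q wp wq =
     (let E = (edges G - {{p, q}}) \<union> {{p, r}, {q, r}}
      in \<lparr> verts = insert r (verts G), edges = E,
           wt = (\<lambda>e\<in>E. if e = {p, r} then wp else if e = {q, r} then wq else wt G e) \<rparr>)"

text \<open>
  Both operations are given as relations, since the definitions involve choices
  (the order of \<open>p\<close> and \<open>q\<close>, the Fiedler vector). The subdivision has the name \<open>r\<close> of
  the new vertex as a parameter.
\<close>

definition char_contraction :: "'a wgraph \<Rightarrow> 'a wgraph \<Rightarrow> bool" where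
  "char_contraction G1 G2 \<longleftrightarrow>
     G1 \<in> T1_2 \<and>
     (\<exists>r p q. characteristic_set G1 {r} \<and> p \<noteq> q \<and> neighbors G1 r = {p, q} \<and>
              G2 = contract G1 p r q)"

definition char_subdivision :: "'a \<Rightarrow> 'a wgraph \<Rightarrow> 'a wgraph \<Rightarrow> bool" where
  "char_subdivision r G2 G1 \<longleftrightarrow>
     G2 \<in> T2 \<and> r \<notin> verts G2 \<and>
     (\<exists>x p q. fiedler_vector G2 x \<and> p \<noteq> q \<and> char_set_of G2 x = {p, q} \<and>
              G1 = subdivide G2 p r q
                     (wt G2 {p, q} * (1 - x q / x p)) (wt G2 {p, q} * (1 - x p / x q)))"

definition wgraph_iso :: "('a \<Rightarrow> 'b) \<Rightarrow> 'a wgraph \<Rightarrow> 'b wgraph \<Rightarrow> bool" where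
  "wgraph_iso f G H \<longleftrightarrow>
     bij_betw f (verts G) (verts H) \<and> edges H = (`) f ` edges G \<and>
     (\<forall>e\<in>edges G. wt H (f ` e) = wt G e)"

end

theory Submission
  imports Defs "HOL-Analysis.Function_Topology"
begin

text \<open>
  Write \<open>wp\<close>, \<open>wq\<close> for the weights of the edges from \<open>p\<close> and \<open>q\<close> to the vertex \<open>r\<close> of degree 2.
  Contracting \<open>r\<close> replaces two resistors in series by one, and the Laplacian of the contraction is
  the Schur complement of the Laplacian at \<open>r\<close> (\<open>lap_contract\<close>). So a function with \<open>x r = 0\<close> and
  \<open>wp * x p + wq * x q = 0\<close> is an eigenfunction of both trees or of neither, for the same
  eigenvalue (\<open>eigenfunction_contract_iff\<close>), and the weights of a characteristic subdivision are
  chosen such that the second equation holds. It remains to see that this eigenvalue is the second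
  smallest one on both sides, and that all Fiedler vectors involved are of this kind.

  For the first point, the algebraic connectivity is described as the least Rayleigh quotient of a
  function of sum zero (\<open>algebraic_connectivity_spectral\<close>). Extending a Fiedler vector of the
  contraction harmonically to \<open>r\<close> shows that contraction does not decrease the algebraic
  connectivity (\<open>connectivity_le_contract\<close>). If the larger tree has a Fiedler vector with
  \<open>x r = 0\<close>, its eigenvalue is a positive eigenvalue of the contraction, which gives equality. If
  instead the smaller tree has a Fiedler vector without zeros, extending it by \<open>x r = 0\<close> removes its
  only sign change, and an eigenfunction that vanishes at a single vertex and has no sign change across
  an edge belongs to an eigenvalue which is at most the algebraic connectivity
  (\<open>eigenvalue_le_connectivity\<close>).

  For the second point, each edge cuts a tree into two sides. Green's identity on one side shows that
  two eigenfunctions for the same eigenvalue are proportional on every edge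
  (\<open>eigenfunctions_proportional_on_edge\<close>), so an eigenvalue is simple as soon as it has an eigenfunction
  without zeros, or one whose only zero is a vertex of degree 2. That a Fiedler vector
  without zeros changes sign across exactly one edge is Fiedler's theorem
  (\<open>sign_change_edge_unique\<close>, \<open>sign_change_edge_exists\<close>): cutting at two such edges would yield a
  test function of sum zero with a Rayleigh quotient that is too small.
\<close>

section \<open>Cuts in trees\<close>

lemma edge_endpoints:
  assumes "simple_graph G" "{a, b} \<in> edges G"
  shows "a \<in> verts G" "b \<in> verts G" "a \<noteq> b"
proof -
  obtain u v where "u \<in> verts G" "v \<in> verts G" "u \<noteq> v" "{a, b} = {u, v}"
    using assms unfolding simple_graph_def by blast
  then show "a \<in> verts G" "b \<in> verts G" "a \<noteq> b"
    by (auto simp: doubleton_eq_iff)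
qed

lemma edge_pairE:
  assumes "simple_graph G" "e \<in> edges G"
  obtains a b where "e = {a, b}" "a \<in> verts G" "b \<in> verts G" "a \<noteq> b"
  using assms unfolding simple_graph_def by blast

text \<open>The edge is oriented, with \<open>a\<close> inside \<open>A\<close>. That every edge has such a side is the form of
  acyclicity used below: summation over one side of an edge is what the spectral arguments
  need, and the sides carry over from a tree to its contraction or subdivision, whereas cycles
  would have to be rerouted.\<close>
definition is_cut :: "'a wgraph \<Rightarrow> 'a set \<Rightarrow> 'a \<Rightarrow> 'a \<Rightarrow> bool" where
  "is_cut G A a b \<longleftrightarrow> A \<subseteq> verts G \<and> a \<in> A \<and> b \<notin> A \<and>
     (\<forall>i k. {i, k} \<in> edges G \<longrightarrow> i \<in> A \<longrightarrow> k \<notin> A \<longrightarrow> i = a \<and> k = b)"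

lemma rtrancl_distinct_path:
  assumes "(a, b) \<in> {(x, y). R x y}\<^sup>*"
  shows "\<exists>vs. vs \<noteq> [] \<and> hd vs = a \<and> last vs = b \<and> distinct vs \<and> successively R vs"
  using assms
proof (induction rule: converse_rtrancl_induct)
  case base
  show ?case by (rule exI[of _ "[b]"]) simp
next
  case (step a c)
  then obtain vs where vs: "vs \<noteq> []" "hd vs = c" "last vs = b" "distinct vs" "successively R vs"
    by blast
  show ?case
  proof (cases "a \<in> set vs")
    case True
    then obtain us ws where "vs = us @ a # ws" by (meson split_list)
    then show ?thesis using vs
      by (intro exI[of _ "a # ws"]) (auto simp: successively_append_iff)
  next
    case False
    then show ?thesis using vs step(1)
      by (intro exI[of _ "a # vs"]) (auto simp: successively_Cons)
  qed
qed

text \<open>The side consists of the vertices that \<open>a\<close> reaches without using the edge. If it contained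
  \<open>b\<close>, then a simple path from \<open>a\<close> to \<open>b\<close> in the remaining graph, closed by the edge, would be
  a cycle.\<close>
lemma tree_edge_cut:
  assumes G: "weighted_tree G" and ab: "{a, b} \<in> edges G"
  shows "\<exists>A. is_cut G A a b"
proof -
  have simple: "simple_graph G" using G by (simp add: weighted_tree_def)
  note ends = edge_endpoints[OF simple]
  define R where "R = (\<lambda>x y. {x, y} \<in> edges G - {{a, b}})"
  define A where "A = {v. (a, v) \<in> {(x, y). R x y}\<^sup>*}"
  have "b \<notin> A"
  proof
    assume "b \<in> A"
    then obtain vs where vs: "vs \<noteq> []" "hd vs = a" "last vs = b" "distinct vs" "successively R vs"
      using rtrancl_distinct_path unfolding A_def by (metis mem_Collect_eq)
    define n where "n = length vs"
    have n0: "n > 0" using vs(1) by (simp add: n_def)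
    have first: "vs ! 0 = a" and last: "vs ! (n - 1) = b"
      using vs by (auto simp: hd_conv_nth last_conv_nth n_def)
    have step: "R (vs ! i) (vs ! Suc i)" if "Suc i < n" for i
      using vs(5) that by (auto simp: successively_conv_nth n_def)
    have "n \<noteq> 1" using first last ends(3)[OF ab] by auto
    \<comment> \<open>A path with two vertices would be the removed edge itself, so the closed path is a genuine cycle.\<close>
    moreover have "n \<noteq> 2"
    proof
      assume "n = 2"
      then show False using step[of 0] first last by (simp add: R_def)
    qed
    ultimately have n3: "3 \<le> n" using n0 by linarith
    have "{vs ! i, vs ! (Suc i mod n)} \<in> edges G" if "i < n" for i
    proof (cases "Suc i = n")
      case True
      then have "i = n - 1" by simp
      then show ?thesis using True first last ab by (simp add: insert_commute)
    next
      case False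
      then show ?thesis using step[of i] that by (simp add: R_def)
    qed
    then have "graph_cycle G vs" using n3 vs(4) by (simp add: graph_cycle_def n_def)
    then show False using G by (auto simp: weighted_tree_def)
  qed
  moreover have "A \<subseteq> verts G"
  proof
    fix v assume "v \<in> A"
    then have "(a, v) \<in> {(x, y). R x y}\<^sup>*" by (simp add: A_def)
    then show "v \<in> verts G"
      by (cases rule: rtranclE) (use ends ab in \<open>auto simp: R_def\<close>)
  qed
  moreover have "i = a \<and> k = b" if "{i, k} \<in> edges G" "i \<in> A" "k \<notin> A" for i k
  proof -
    have "\<not> R i k" using that(2,3) unfolding A_def by (auto intro: rtrancl_into_rtrancl)
    then have "{i, k} = {a, b}" using that(1) by (simp add: R_def)
    then show ?thesis using that(2) \<open>b \<notin> A\<close> by (auto simp: doubleton_eq_iff)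
  qed
  moreover have "a \<in> A" by (simp add: A_def)
  ultimately show ?thesis unfolding is_cut_def by blast
qed

text \<open>Take the side of the edge that closes the cycle. All other edges of the cycle stay on that
  side, so walking along them never reaches the other end of the closing edge.\<close>
lemma cuts_imp_acyclic:
  assumes cut: "\<And>a b. {a, b} \<in> edges G \<Longrightarrow> \<exists>A. is_cut G A a b"
  shows "\<nexists>vs. graph_cycle G vs"
proof
  assume "\<exists>vs. graph_cycle G vs"
  then obtain vs where vs: "3 \<le> length vs" "distinct vs"
    and edge: "\<And>i. i < length vs \<Longrightarrow> {vs ! i, vs ! (Suc i mod length vs)} \<in> edges G"
    by (auto simp: graph_cycle_def)
  define n where "n = length vs"
  have "{vs ! (n - 1), vs ! (Suc (n - 1) mod n)} \<in> edges G"
    using edge[of "n - 1"] vs(1) by (simp add: n_def)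
  moreover have "Suc (n - 1) = n" using vs(1) by (simp add: n_def)
  ultimately have "{vs ! 0, vs ! (n - 1)} \<in> edges G" by (simp add: insert_commute)
  then obtain A where A: "is_cut G A (vs ! 0) (vs ! (n - 1))" using cut by blast
  have "i < n \<longrightarrow> vs ! i \<in> A" for i
  proof (induction i)
    case 0
    show ?case using A by (simp add: is_cut_def)
  next
    case (Suc i)
    show ?case
    proof
      assume i: "Suc i < n"
      then have "{vs ! i, vs ! Suc i} \<in> edges G" using edge[of i] by (simp add: n_def)
      moreover have "vs ! i \<in> A" using Suc i by simp
      moreover have "\<not> (vs ! i = vs ! 0 \<and> vs ! Suc i = vs ! (n - 1))"
      proof
        assume "vs ! i = vs ! 0 \<and> vs ! Suc i = vs ! (n - 1)"
        then have "i = 0" "Suc i = n - 1"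
          using i vs(1) nth_eq_iff_index_eq[OF vs(2), of i 0]
            nth_eq_iff_index_eq[OF vs(2), of "Suc i" "n - 1"] unfolding n_def by linarith+
        then show False using vs(1) by (simp add: n_def)
      qed
      ultimately show "vs ! Suc i \<in> A" using A unfolding is_cut_def by blast
    qed
  qed
  moreover have "n - 1 < n" using vs(1) by (simp add: n_def)
  ultimately show False using A by (auto simp: is_cut_def)
qed

lemma cut_other_edge:
  assumes "is_cut G A a b" "{i, k} \<in> edges G" "{i, k} \<noteq> {a, b}"
  shows "i \<in> A \<longleftrightarrow> k \<in> A"
proof -
  have "{k, i} \<in> edges G" "{i, k} \<noteq> {b, a}"
    using assms(2,3) by (simp_all add: insert_commute)
  then show ?thesis using assms unfolding is_cut_def by blast
qed

lemma is_cutD: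
  assumes "is_cut G A a b"
  shows "A \<subseteq> verts G" "a \<in> A" "b \<notin> A"
  using assms by (simp_all add: is_cut_def)

lemma is_cutI:
  assumes "A \<subseteq> verts G" "a \<in> A" "b \<notin> A"
    and "\<And>i k. {i, k} \<in> edges G \<Longrightarrow> {i, k} \<noteq> {a, b} \<Longrightarrow> i \<in> A \<Longrightarrow> k \<in> A"
  shows "is_cut G A a b"
proof -
  have "i = a \<and> k = b" if "{i, k} \<in> edges G" "i \<in> A" "k \<notin> A" for i k
  proof -
    have "{i, k} = {a, b}" using assms(4) that by blast
    then show ?thesis using that(2) assms(3) by (auto simp: doubleton_eq_iff)
  qed
  then show ?thesis unfolding is_cut_def using assms(1-3) by blast
qed

section \<open>Contraction and subdivision of trees\<close>

lemma weighted_treeI: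
  assumes "finite (verts G)" "verts G \<noteq> {}"
    and "\<And>e. e \<in> edges G \<Longrightarrow> \<exists>a\<in>verts G. \<exists>b\<in>verts G. a \<noteq> b \<and> e = {a, b}"
    and "\<And>u v. u \<in> verts G \<Longrightarrow> v \<in> verts G \<Longrightarrow> (u, v) \<in> {(a, b). {a, b} \<in> edges G}\<^sup>*"
    and "\<And>a b. {a, b} \<in> edges G \<Longrightarrow> \<exists>A. is_cut G A a b"
    and "wt G \<in> edges G \<rightarrow>\<^sub>E {0<..}"
  shows "weighted_tree G"
proof -
  have "simple_graph G" unfolding simple_graph_def using assms(1,3) by blast
  moreover have "connected_graph G" unfolding connected_graph_def using assms(2,4) by blast
  moreover have "\<nexists>vs. graph_cycle G vs" using cuts_imp_acyclic assms(5) .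
  ultimately show ?thesis unfolding weighted_tree_def using assms(6) by simp
qed

lemma weighted_treeD:
  assumes "weighted_tree G"
  shows "finite (verts G)" "verts G \<noteq> {}" "simple_graph G"
    and "u \<in> verts G \<Longrightarrow> v \<in> verts G \<Longrightarrow> (u, v) \<in> {(a, b). {a, b} \<in> edges G}\<^sup>*"
    and "wt G \<in> edges G \<rightarrow>\<^sub>E {0<..}" "e \<in> edges G \<Longrightarrow> 0 < wt G e"
  using assms unfolding weighted_tree_def simple_graph_def connected_graph_def
  by (auto dest: PiE_mem)

text \<open>A triangle would be a cycle. Hence the edge introduced by a contraction is new, no edge weight is
  overwritten, and the contraction can be undone.\<close>
lemma tree_no_triangle:
  assumes G: "weighted_tree G" and N: "neighbors G r = {p, q}" and pq: "p \<noteq> q"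
  shows "{p, q} \<notin> edges G"
proof
  assume e: "{p, q} \<in> edges G"
  have er: "{p, r} \<in> edges G" "{q, r} \<in> edges G" using N by (auto simp: neighbors_def)
  note ends = edge_endpoints[OF weighted_treeD(3)[OF G]]
  obtain A where A: "is_cut G A p r" using tree_edge_cut[OF G er(1)] by blast
  have "{p, q} \<noteq> {p, r}" "{q, r} \<noteq> {p, r}"
    using ends(3)[OF er(1)] ends(3)[OF er(2)] pq by (auto simp: doubleton_eq_iff)
  then have "p \<in> A \<longleftrightarrow> q \<in> A" "q \<in> A \<longleftrightarrow> r \<in> A"
    using cut_other_edge[OF A] e er by blast+
  then show False using A by (auto simp: is_cut_def)
qed

lemma contract_simps:
  "verts (contract G p r q) = verts G - {r}"
  "edges (contract G p r q) = insert {p, q} (edges G - {{p, r}, {q, r}})"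
  "wt (contract G p r q) =
     (\<lambda>e\<in>edges (contract G p r q).
        if e = {p, q} then wt G {p, r} * wt G {q, r} / (wt G {p, r} + wt G {q, r}) else wt G e)"
  by (simp_all add: contract_def Let_def)

lemma subdivide_simps:
  "verts (subdivide G p r q wp wq) = insert r (verts G)"
  "edges (subdivide G p r q wp wq) = (edges G - {{p, q}}) \<union> {{p, r}, {q, r}}"
  "wt (subdivide G p r q wp wq) =
     (\<lambda>e\<in>edges (subdivide G p r q wp wq).
        if e = {p, r} then wp else if e = {q, r} then wq else wt G e)"
  by (simp_all add: subdivide_def Let_def)

lemma wt_subdivide_new:
  assumes "p \<noteq> q"
  shows "wt (subdivide G p r q wp wq) {p, r} = wp" "wt (subdivide G p r q wp wq) {q, r} = wq"
proof -
  have "{q, r} \<noteq> {p, r}" using assms by (auto simp: doubleton_eq_iff)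
  then show "wt (subdivide G p r q wp wq) {p, r} = wp" "wt (subdivide G p r q wp wq) {q, r} = wq"
    by (simp_all add: subdivide_simps(2,3))
qed

lemma contract_commute: "contract G p r q = contract G q r p"
  unfolding contract_def Let_def
  by (simp only: insert_commute[of q p "{}"] insert_commute[of "{q, r}" "{p, r}" "{}"]
      mult.commute[of "wt G {q, r}" "wt G {p, r}"] add.commute[of "wt G {q, r}" "wt G {p, r}"])

lemma subdivide_commute:
  assumes "p \<noteq> q"
  shows "subdivide G p r q wp wq = subdivide G q r p wq wp"
proof -
  have "{p, r} \<noteq> {q, r}" using assms by (auto simp: doubleton_eq_iff)
  then have "(if e = {p, r} then wp else if e = {q, r} then wq else wt G e)
      = (if e = {q, r} then wq else if e = {p, r} then wp else wt G e)" for e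
    by simp
  then show ?thesis
    unfolding subdivide_def Let_def
    by (simp only: insert_commute[of q p "{}"] insert_commute[of "{q, r}" "{p, r}" "{}"])
qed

text \<open>A side of \<open>{a, r}\<close>, for a neighbour \<open>a\<close> of \<open>r\<close>, becomes a side of the new edge \<open>{p, q}\<close>. A
  side of any other edge contains all or none of \<open>p\<close>, \<open>r\<close>, \<open>q\<close> and only has to forget \<open>r\<close>.\<close>
lemma contract_tree:
  assumes G: "weighted_tree G" and N: "neighbors G r = {p, q}" and pq: "p \<noteq> q"
  shows "weighted_tree (contract G p r q)" (is "weighted_tree ?H")
proof (rule weighted_treeI)
  note simple = weighted_treeD(3)[OF G]
  note ends = edge_endpoints[OF simple]
  have er: "{p, r} \<in> edges G" "{q, r} \<in> edges G" using N by (auto simp: neighbors_def)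
  have ne: "p \<noteq> r" "q \<noteq> r" using ends(3) er by auto
  have inc: "i = p \<or> i = q" if "{i, r} \<in> edges G" for i
    using that N by (auto simp: neighbors_def)
  have edgeH: "{i, k} \<in> edges ?H \<longleftrightarrow> {i, k} = {p, q} \<or> {i, k} \<in> edges G \<and> i \<noteq> r \<and> k \<noteq> r" for i k
    using inc[of i] inc[of k] ne
    by (auto simp: contract_simps doubleton_eq_iff insert_commute)
  show "finite (verts ?H)" using weighted_treeD(1)[OF G] by (simp add: contract_simps)
  show "verts ?H \<noteq> {}" using ends(1)[OF er(1)] ne by (auto simp: contract_simps)
  show "\<exists>a\<in>verts ?H. \<exists>b\<in>verts ?H. a \<noteq> b \<and> e = {a, b}" if e: "e \<in> edges ?H" for e
  proof (cases "e = {p, q}")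
    case True
    then show ?thesis using ends(1)[OF er(1)] ends(1)[OF er(2)] ne pq
      by (auto simp: contract_simps)
  next
    case False
    then have "e \<in> edges G" using e by (simp add: contract_simps)
    then obtain a b where ab: "e = {a, b}" "a \<in> verts G" "b \<in> verts G" "a \<noteq> b"
      using edge_pairE[OF simple] by blast
    then have "a \<noteq> r" "b \<noteq> r" using edgeH[of a b] e False by auto
    then show ?thesis using ab by (auto simp: contract_simps)
  qed
  show "(u, v) \<in> {(a, b). {a, b} \<in> edges ?H}\<^sup>*" (is "_ \<in> ?R\<^sup>*")
    if u: "u \<in> verts ?H" and v: "v \<in> verts ?H" for u v
  proof -
    have "(u, v) \<in> {(a, b). {a, b} \<in> edges G}\<^sup>*"
      using weighted_treeD(4)[OF G] u v by (simp add: contract_simps)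
    then have "(v \<noteq> r \<longrightarrow> (u, v) \<in> ?R\<^sup>*) \<and> (v = r \<longrightarrow> (u, p) \<in> ?R\<^sup>* \<and> (u, q) \<in> ?R\<^sup>*)"
    proof (induction rule: rtrancl_induct)
      case base
      then show ?case using u by (simp add: contract_simps)
    next
      case (step v w)
      have pqR: "(p, q) \<in> ?R" "(q, p) \<in> ?R" using edgeH by auto
      show ?case
      proof (cases "v = r \<or> w = r")
        case True
        then have "v = r \<and> (w = p \<or> w = q) \<or> w = r \<and> (v = p \<or> v = q)"
          using step(2) inc[of v] inc[of w] by (auto simp: insert_commute)
        then show ?thesis using step(3) pqR ne by (auto intro: rtrancl_into_rtrancl)
      next
        case False
        then have "(v, w) \<in> ?R" using step(2) edgeH by simp
        then show ?thesis using step(3) False by (auto intro: rtrancl_into_rtrancl)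
      qed
    qed
    then show ?thesis using v by (simp add: contract_simps)
  qed
  show "\<exists>A. is_cut ?H A a b" if ab: "{a, b} \<in> edges ?H" for a b
  proof (cases "{a, b} = {p, q}")
    case True
    have "{a, r} \<in> edges G" "{b, r} \<in> edges G" "a \<noteq> b"
      using True er pq by (auto simp: doubleton_eq_iff)
    then obtain A where A: "is_cut G A a r" using tree_edge_cut[OF G] by blast
    have "{b, r} \<noteq> {a, r}" using \<open>a \<noteq> b\<close> by (auto simp: doubleton_eq_iff)
    then have "b \<notin> A" "r \<notin> A" using cut_other_edge[OF A \<open>{b, r} \<in> edges G\<close>] A
      by (auto simp: is_cut_def)
    have "is_cut ?H A a b"
    proof (rule is_cutI)
      show "A \<subseteq> verts ?H" "a \<in> A" using A \<open>r \<notin> A\<close> by (auto simp: is_cut_def contract_simps)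
      show "b \<notin> A" by fact
      fix i k assume ik: "{i, k} \<in> edges ?H" "{i, k} \<noteq> {a, b}" "i \<in> A"
      then have "{i, k} \<in> edges G" "k \<noteq> r" using edgeH[of i k] True by auto
      then show "k \<in> A" using A ik(3) unfolding is_cut_def by blast
    qed
    then show ?thesis by blast
  next
    case False
    then have abG: "{a, b} \<in> edges G" "a \<noteq> r" "b \<noteq> r" using edgeH ab by auto
    then obtain A where A: "is_cut G A a b" using tree_edge_cut[OF G] by blast
    have "p \<in> A \<longleftrightarrow> r \<in> A" "q \<in> A \<longleftrightarrow> r \<in> A"
      using cut_other_edge[OF A er(1)] cut_other_edge[OF A er(2)] abG ne
      by (auto simp: doubleton_eq_iff)
    have "is_cut ?H (A - {r}) a b"
    proof (rule is_cutI)
      show "A - {r} \<subseteq> verts ?H" "a \<in> A - {r}" "b \<notin> A - {r}"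
        using is_cutD[OF A] abG by (auto simp: contract_simps(1))
      fix i k assume ik: "{i, k} \<in> edges ?H" "{i, k} \<noteq> {a, b}" "i \<in> A - {r}"
      show "k \<in> A - {r}"
      proof (cases "{i, k} = {p, q}")
        case True
        then show ?thesis using ik(3) ne \<open>p \<in> A \<longleftrightarrow> r \<in> A\<close> \<open>q \<in> A \<longleftrightarrow> r \<in> A\<close>
          by (auto simp: doubleton_eq_iff)
      next
        case False
        then show ?thesis using edgeH[of i k] ik cut_other_edge[OF A, of i k] by auto
      qed
    qed
    then show ?thesis by blast
  qed
  have "0 < wt G {p, r}" "0 < wt G {q, r}" using weighted_treeD(6)[OF G] er by auto
  then have "0 < wt G {p, r} * wt G {q, r} / (wt G {p, r} + wt G {q, r})" by simp
  moreover have "0 < wt G e" if "e \<in> edges ?H" "e \<noteq> {p, q}" for e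
    using that weighted_treeD(6)[OF G] by (simp add: contract_simps(2))
  ultimately show "wt ?H \<in> edges ?H \<rightarrow>\<^sub>E {0<..}"
    unfolding contract_simps(3) restrict_PiE_iff by simp
qed

text \<open>The two sides of \<open>{p, q}\<close> serve the two new edges, with \<open>r\<close> added where it has to be inside.
  A side of any other edge does not separate \<open>p\<close> from \<open>q\<close>, and \<open>r\<close> joins them.\<close>
lemma subdivide_tree:
  assumes G: "weighted_tree G" and epq: "{p, q} \<in> edges G" and r: "r \<notin> verts G"
    and pos: "0 < wp" "0 < wq"
  shows "weighted_tree (subdivide G p r q wp wq)" (is "weighted_tree ?H")
proof (rule weighted_treeI)
  note simple = weighted_treeD(3)[OF G]
  note ends = edge_endpoints[OF simple]
  have ne: "p \<noteq> r" "q \<noteq> r" "p \<noteq> q" using ends epq r by auto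
  have notr: "a \<noteq> r" "b \<noteq> r" if "{a, b} \<in> edges G" for a b using ends that r by blast+
  have edgeH: "{i, k} \<in> edges ?H \<longleftrightarrow>
      {i, k} = {p, r} \<or> {i, k} = {q, r} \<or> {i, k} \<in> edges G \<and> {i, k} \<noteq> {p, q}" for i k
    by (auto simp: subdivide_simps)
  show "finite (verts ?H)" using weighted_treeD(1)[OF G] by (simp add: subdivide_simps)
  show "verts ?H \<noteq> {}" by (simp add: subdivide_simps)
  show "\<exists>a\<in>verts ?H. \<exists>b\<in>verts ?H. a \<noteq> b \<and> e = {a, b}" if e: "e \<in> edges ?H" for e
  proof (cases "e = {p, r} \<or> e = {q, r}")
    case True
    then show ?thesis using ends epq ne by (auto simp: subdivide_simps)
  next
    case False
    then have "e \<in> edges G" using e by (auto simp: subdivide_simps)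
    then obtain a b where ab: "e = {a, b}" "a \<in> verts G" "b \<in> verts G" "a \<noteq> b"
      using edge_pairE[OF simple] by blast
    then show ?thesis by (auto simp: subdivide_simps)
  qed
  show "(u, v) \<in> {(a, b). {a, b} \<in> edges ?H}\<^sup>*" (is "_ \<in> ?R\<^sup>*")
    if u: "u \<in> verts ?H" and v: "v \<in> verts ?H" for u v
  proof -
    have pr: "(p, r) \<in> ?R" "(r, p) \<in> ?R" "(q, r) \<in> ?R" "(r, q) \<in> ?R"
      using edgeH by (auto simp: insert_commute)
    have old: "(u, v) \<in> ?R\<^sup>*" if "u \<in> verts G" "v \<in> verts G" for u v
    proof -
      have "(u, v) \<in> {(a, b). {a, b} \<in> edges G}\<^sup>*" using weighted_treeD(4)[OF G that] .
      then show ?thesis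
      proof (induction rule: rtrancl_induct)
        case base
        then show ?case by simp
      next
        case (step v w)
        have "(v, w) \<in> ?R\<^sup>*"
        proof (cases "{v, w} = {p, q}")
          case True
          then have "v = p \<and> w = q \<or> v = q \<and> w = p" by (auto simp: doubleton_eq_iff)
          then show ?thesis using pr by (meson converse_rtrancl_into_rtrancl r_into_rtrancl)
        next
          case False
          then show ?thesis using step(2) edgeH by auto
        qed
        then show ?case using step(3) by (meson rtrancl_trans)
      qed
    qed
    have pV: "p \<in> verts G" using ends epq by blast
    have "(u, p) \<in> ?R\<^sup>*"
      using old[OF _ pV] pr u by (auto simp: subdivide_simps)
    moreover have "(p, v) \<in> ?R\<^sup>*"
      using old[OF pV] pr v by (auto simp: subdivide_simps)
    ultimately show ?thesis by (meson rtrancl_trans)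
  qed
  have cut_new: "\<exists>A. is_cut ?H A a r \<and> (\<exists>A. is_cut ?H A r a)"
    if ab: "{a, b} = {p, q}" for a b
  proof -
    have "{a, b} \<in> edges G" "{b, a} \<in> edges G" "a \<noteq> b"
      using epq ab ne by (auto simp: insert_commute)
    then obtain A B where A: "is_cut G A a b" and B: "is_cut G B b a"
      using tree_edge_cut[OF G] by blast
    have "r \<notin> A" "r \<notin> B" using A B r by (auto simp: is_cut_def)
    have edgeH': "{i, k} \<in> edges ?H \<longleftrightarrow>
      {i, k} = {a, r} \<or> {i, k} = {b, r} \<or> {i, k} \<in> edges G \<and> {i, k} \<noteq> {a, b}" for i k
      using ab edgeH[of i k] by (auto simp: doubleton_eq_iff)
    have "is_cut ?H A a r"
    proof (rule is_cutI)
      show "A \<subseteq> verts ?H" "a \<in> A" "r \<notin> A"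
        using A \<open>r \<notin> A\<close> by (auto simp: is_cut_def subdivide_simps)
      fix i k assume ik: "{i, k} \<in> edges ?H" "{i, k} \<noteq> {a, r}" "i \<in> A"
      then have "{i, k} \<in> edges G \<and> {i, k} \<noteq> {a, b}"
        using edgeH'[of i k] A \<open>r \<notin> A\<close> by (auto simp: is_cut_def doubleton_eq_iff)
      then show "k \<in> A" using cut_other_edge[OF A] ik(3) by blast
    qed
    moreover have "is_cut ?H (insert r B) r a"
    proof (rule is_cutI)
      show "insert r B \<subseteq> verts ?H" "r \<in> insert r B" "a \<notin> insert r B"
        using B ab ne by (auto simp: is_cut_def subdivide_simps doubleton_eq_iff)
      fix i k assume ik: "{i, k} \<in> edges ?H" "{i, k} \<noteq> {r, a}" "i \<in> insert r B"
      then have "{i, k} = {b, r} \<or> {i, k} \<in> edges G \<and> {i, k} \<noteq> {b, a}"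
        using edgeH'[of i k] by (auto simp: insert_commute)
      then show "k \<in> insert r B" using cut_other_edge[OF B, of i k] ik(3) B notr(1)[of i k]
        by (auto simp: is_cut_def doubleton_eq_iff)
    qed
    ultimately show ?thesis by blast
  qed
  show "\<exists>A. is_cut ?H A a b" if ab: "{a, b} \<in> edges ?H" for a b
  proof (cases "a = r \<or> b = r")
    case True
    then have "a = r \<and> (b = p \<or> b = q) \<or> b = r \<and> (a = p \<or> a = q)"
      using ab edgeH[of a b] notr by (auto simp: doubleton_eq_iff)
    then show ?thesis using cut_new[of p q] cut_new[of q p] by (auto simp: insert_commute)
  next
    case False
    then have abG: "{a, b} \<in> edges G" "{a, b} \<noteq> {p, q}"
      using edgeH[of a b] ab by (auto simp: doubleton_eq_iff)
    then obtain A where A: "is_cut G A a b" using tree_edge_cut[OF G] by blast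
    have pqA: "p \<in> A \<longleftrightarrow> q \<in> A" using cut_other_edge[OF A epq] abG(2) by auto
    have rA: "r \<notin> A" using A r by (auto simp: is_cut_def)
    have "is_cut ?H (if p \<in> A then insert r A else A) a b" (is "is_cut _ ?B _ _")
    proof (rule is_cutI)
      show "?B \<subseteq> verts ?H" "a \<in> ?B" "b \<notin> ?B"
        using A False by (auto simp: is_cut_def subdivide_simps)
      fix i k assume ik: "{i, k} \<in> edges ?H" "{i, k} \<noteq> {a, b}" "i \<in> ?B"
      show "k \<in> ?B"
      proof (cases "{i, k} = {p, r} \<or> {i, k} = {q, r}")
        case True
        then show ?thesis using ik(3) pqA rA by (auto simp: doubleton_eq_iff split: if_splits)
      next
        case False
        then have "{i, k} \<in> edges G" using ik(1) edgeH by blast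
        then show ?thesis
          using cut_other_edge[OF A _ ik(2)] ik(3) notr by (auto split: if_splits)
      qed
    qed
    then show ?thesis by blast
  qed
  have "0 < wt G e" if "e \<in> edges ?H" "e \<noteq> {p, r}" "e \<noteq> {q, r}" for e
    using that weighted_treeD(6)[OF G] by (simp add: subdivide_simps(2))
  then show "wt ?H \<in> edges ?H \<rightarrow>\<^sub>E {0<..}"
    unfolding subdivide_simps(3) restrict_PiE_iff using pos by simp
qed

lemma neighbors_subdivide:
  assumes "simple_graph G" "r \<notin> verts G"
  shows "neighbors (subdivide G p r q wp wq) r = {p, q}"
  using edge_endpoints(1,2)[OF assms(1)] assms(2)
  by (auto simp: neighbors_def subdivide_simps doubleton_eq_iff)

lemma subdivide_contract:
  assumes G: "weighted_tree G" and N: "neighbors G r = {p, q}" and pq: "p \<noteq> q"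
  shows "subdivide (contract G p r q) p r q (wt G {p, r}) (wt G {q, r}) = G"
proof -
  have er: "{p, r} \<in> edges G" "{q, r} \<in> edges G" using N by (auto simp: neighbors_def)
  note tri = tree_no_triangle[OF G N pq]
  have r: "r \<in> verts G" using edge_endpoints(2)[OF weighted_treeD(3)[OF G] er(1)] .
  have E: "insert {p, q} (edges G - {{p, r}, {q, r}}) - {{p, q}} \<union> {{p, r}, {q, r}} = edges G"
    using er tri by auto
  have "(\<lambda>e\<in>edges G. if e = {p, r} then wt G {p, r} else if e = {q, r} then wt G {q, r}
           else wt (contract G p r q) e) = wt G"
    using weighted_treeD(5)[OF G] tri
    by (auto simp: fun_eq_iff contract_simps restrict_def PiE_def extensional_def)
  then have "subdivide (contract G p r q) p r q (wt G {p, r}) (wt G {q, r})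
      = \<lparr>verts = verts G, edges = edges G, wt = wt G\<rparr>"
    unfolding subdivide_def Let_def using E r by (simp add: contract_simps insert_absorb)
  then show ?thesis by simp
qed

lemma contract_subdivide:
  assumes G: "weighted_tree G" and epq: "{p, q} \<in> edges G" and r: "r \<notin> verts G"
    and w: "wp * wq / (wp + wq) = wt G {p, q}"
  shows "contract (subdivide G p r q wp wq) p r q = G"
proof -
  note ends = edge_endpoints[OF weighted_treeD(3)[OF G]]
  have pq: "p \<noteq> q" using ends epq by blast
  have notr: "{a, r} \<notin> edges G" for a using ends(2) r by blast
  have ne: "{p, r} \<noteq> {q, r}" using pq by (auto simp: doubleton_eq_iff)
  have E: "insert {p, q} ((edges G - {{p, q}}) \<union> {{p, r}, {q, r}} - {{p, r}, {q, r}}) = edges G"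
    using notr epq by auto
  have wpr: "wt (subdivide G p r q wp wq) {p, r} = wp" "wt (subdivide G p r q wp wq) {q, r} = wq"
    using ne by (auto simp: subdivide_simps)
  have "(\<lambda>e\<in>edges G. if e = {p, q} then wp * wq / (wp + wq)
           else wt (subdivide G p r q wp wq) e) = wt G"
  proof
    fix e
    show "(\<lambda>e\<in>edges G. if e = {p, q} then wp * wq / (wp + wq)
           else wt (subdivide G p r q wp wq) e) e = wt G e"
      using weighted_treeD(5)[OF G] w notr[of p] notr[of q]
      by (cases "e = {p, r} \<or> e = {q, r}")
        (auto simp: subdivide_simps PiE_def extensional_def)
  qed
  then have "contract (subdivide G p r q wp wq) p r q
      = \<lparr>verts = verts G, edges = edges G, wt = wt G\<rparr>"
    unfolding contract_def Let_def wpr using E r by (simp add: subdivide_simps)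
  then show ?thesis by simp
qed

section \<open>The Laplacian as an operator on functions\<close>

definition edge_weight :: "'a wgraph \<Rightarrow> 'a \<Rightarrow> 'a \<Rightarrow> real" where
  "edge_weight G i k = (if {i, k} \<in> edges G then wt G {i, k} else 0)"

text \<open>On functions, the eigenvector equation is a condition at each vertex and does not refer to the
  enumeration of the vertices that the matrix depends on.\<close>
definition lap :: "'a wgraph \<Rightarrow> ('a \<Rightarrow> real) \<Rightarrow> 'a \<Rightarrow> real" where
  "lap G x i = (\<Sum>k\<in>verts G. edge_weight G i k * (x i - x k))"

definition eigenfunction :: "'a wgraph \<Rightarrow> real \<Rightarrow> ('a \<Rightarrow> real) \<Rightarrow> bool" where
  "eigenfunction G c x \<longleftrightarrow> (\<exists>i\<in>verts G. x i \<noteq> 0) \<and> (\<forall>i\<in>verts G. lap G x i = c * x i)"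

lemma edge_weight_commute: "edge_weight G i k = edge_weight G k i"
  by (simp add: edge_weight_def insert_commute)

lemma sum_swap_symmetric:
  fixes f :: "'a \<Rightarrow> 'a \<Rightarrow> real"
  shows "(\<Sum>i\<in>S. \<Sum>k\<in>S. f i k) = (\<Sum>i\<in>S. \<Sum>k\<in>S. (f i k + f k i) / 2)"
proof -
  have "(\<Sum>i\<in>S. \<Sum>k\<in>S. f i k) = (\<Sum>i\<in>S. \<Sum>k\<in>S. f k i)"
    by (rule sum.swap)
  then have "2 * (\<Sum>i\<in>S. \<Sum>k\<in>S. f i k) = (\<Sum>i\<in>S. \<Sum>k\<in>S. f i k + f k i)"
    by (simp add: sum.distrib)
  then show ?thesis by (simp add: sum_divide_distrib[symmetric])
qed

text \<open>The Dirichlet form of the network. It shows at once that the Laplacian is symmetric, positive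
  semidefinite, and has image of sum zero.\<close>
lemma sum_lap_mult:
  "(\<Sum>i\<in>verts G. y i * lap G x i)
    = (\<Sum>i\<in>verts G. \<Sum>k\<in>verts G. edge_weight G i k * (y i - y k) * (x i - x k)) / 2"
proof -
  have "(\<Sum>i\<in>verts G. y i * lap G x i)
      = (\<Sum>i\<in>verts G. \<Sum>k\<in>verts G. y i * (edge_weight G i k * (x i - x k)))"
    by (simp add: lap_def sum_distrib_left)
  also have "\<dots> = (\<Sum>i\<in>verts G. \<Sum>k\<in>verts G.
      edge_weight G i k * (y i - y k) * (x i - x k) / 2)"
  proof (subst sum_swap_symmetric, intro sum.cong refl)
    fix i k
    show "(y i * (edge_weight G i k * (x i - x k)) + y k * (edge_weight G k i * (x k - x i))) / 2
      = edge_weight G i k * (y i - y k) * (x i - x k) / 2"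
      by (simp add: edge_weight_commute[of G k i] algebra_simps)
  qed
  finally show ?thesis by (simp add: sum_divide_distrib)
qed

lemma lap_self_adjoint:
  "(\<Sum>i\<in>verts G. y i * lap G x i) = (\<Sum>i\<in>verts G. x i * lap G y i)"
  unfolding sum_lap_mult by (simp add: mult_ac)

lemma sum_lap: "(\<Sum>i\<in>verts G. lap G x i) = 0"
  using sum_lap_mult[of "\<lambda>_. 1" G x] by simp

lemma lap_linear:
  "lap G (\<lambda>i. a * x i + b * y i) i = a * lap G x i + b * lap G y i"
proof -
  have "lap G (\<lambda>i. a * x i + b * y i) i = (\<Sum>k\<in>verts G.
      a * (edge_weight G i k * (x i - x k)) + b * (edge_weight G i k * (y i - y k)))"
    unfolding lap_def by (rule sum.cong) (simp_all add: algebra_simps)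
  then show ?thesis by (simp add: lap_def sum.distrib sum_distrib_left)
qed

lemma lap_const: "lap G (\<lambda>i. c) i = 0"
  by (simp add: lap_def)

lemma lap_shift: "lap G (\<lambda>i. x i - c) i = lap G x i"
  by (simp add: lap_def)

lemma lap_cong: "(\<And>k. k \<in> verts G \<Longrightarrow> x k = y k) \<Longrightarrow> i \<in> verts G \<Longrightarrow> lap G x i = lap G y i"
  by (simp add: lap_def)

lemma eigenfunction_sum_zero:
  assumes "eigenfunction G c x" "c \<noteq> 0"
  shows "(\<Sum>i\<in>verts G. x i) = 0"
proof -
  have "(\<Sum>i\<in>verts G. lap G x i) = c * (\<Sum>i\<in>verts G. x i)"
    using assms(1) by (simp add: eigenfunction_def sum_distrib_left)
  then show ?thesis using assms(2) by (simp add: sum_lap)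
qed

lemma eigenfunction_quadratic:
  assumes "eigenfunction G c x"
  shows "(\<Sum>i\<in>verts G. x i * lap G x i) = c * (\<Sum>i\<in>verts G. (x i)\<^sup>2)"
proof -
  have "(\<Sum>i\<in>verts G. x i * lap G x i) = (\<Sum>i\<in>verts G. c * (x i)\<^sup>2)"
    using assms by (intro sum.cong) (simp_all add: eigenfunction_def power2_eq_square)
  then show ?thesis by (simp add: sum_distrib_left)
qed

locale connected_network =
  fixes G :: "'a wgraph"
  assumes simple: "simple_graph G"
    and connected: "connected_graph G"
    and wt_pos: "e \<in> edges G \<Longrightarrow> 0 < wt G e"
begin

abbreviation "V \<equiv> verts G"
abbreviation "W \<equiv> edge_weight G"

lemma finite_V: "finite V" and V_nonempty: "V \<noteq> {}"
  using simple connected by (simp_all add: simple_graph_def connected_graph_def)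

lemma W_nonneg: "0 \<le> W i k"
  using wt_pos[of "{i, k}"] by (simp add: edge_weight_def less_imp_le)

lemma W_pos_iff: "0 < W i k \<longleftrightarrow> {i, k} \<in> edges G"
  using wt_pos[of "{i, k}"] by (auto simp: edge_weight_def)

lemma W_diag: "W i i = 0"
  using edge_endpoints(3)[OF simple, of i i] by (auto simp: edge_weight_def)

lemma sum_squares_pos:
  assumes "\<exists>i\<in>V. x i \<noteq> 0"
  shows "0 < (\<Sum>i\<in>V. (x i :: real)\<^sup>2)"
proof -
  obtain i where "i \<in> V" "x i \<noteq> 0" using assms by blast
  then show ?thesis using sum_pos2[OF finite_V, of i "\<lambda>i. (x i)\<^sup>2"] by simp
qed

lemma connected_propagate:
  assumes "u \<in> V" "P u"
    and "\<And>i k. {i, k} \<in> edges G \<Longrightarrow> P i \<Longrightarrow> P k"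
    and "v \<in> V"
  shows "P v"
proof -
  have "(u, v) \<in> {(a, b). {a, b} \<in> edges G}\<^sup>*"
    using connected assms(1,4) by (auto simp: connected_graph_def)
  then show ?thesis
    by (induction rule: rtrancl_induct) (use assms(2,3) in auto)
qed

lemma quadratic_nonneg: "0 \<le> (\<Sum>i\<in>V. x i * lap G x i)"
  unfolding sum_lap_mult
  by (simp add: mult.assoc power2_eq_square[symmetric] sum_nonneg W_nonneg)

text \<open>Every edge contributes a nonnegative term to the Dirichlet form, so all these terms vanish and
  \<open>x\<close> does not change across any edge.\<close>
lemma quadratic_zero_imp_constant:
  assumes "(\<Sum>i\<in>V. x i * lap G x i) = 0" "i \<in> V" "k \<in> V"
  shows "x i = x k"
proof -
  have "(\<Sum>i\<in>V. \<Sum>k\<in>V. W i k * (x i - x k)\<^sup>2) = 0"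
    using assms(1) unfolding sum_lap_mult by (simp add: power2_eq_square mult.assoc)
  then have zero: "W i k * (x i - x k)\<^sup>2 = 0" if "i \<in> V" "k \<in> V" for i k
    using that finite_V W_nonneg by (simp add: sum_nonneg_eq_0_iff sum_nonneg)
  show ?thesis
  proof (rule connected_propagate[of i "\<lambda>k. x i = x k", OF assms(2) refl _ assms(3)])
    fix a b assume e: "{a, b} \<in> edges G" "x i = x a"
    have "W a b * (x a - x b)\<^sup>2 = 0" using zero edge_endpoints[OF simple e(1)] by blast
    moreover have "0 < W a b" using W_pos_iff e(1) by blast
    ultimately show "x i = x b" using e(2) by simp
  qed
qed

lemma lap_zero_imp_constant:
  assumes "\<And>i. i \<in> V \<Longrightarrow> lap G x i = 0" "i \<in> V" "k \<in> V"
  shows "x i = x k"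
  using quadratic_zero_imp_constant[OF _ assms(2,3)] assms(1) by simp

lemma eigenvalue_nonneg:
  assumes "eigenfunction G c x" shows "0 \<le> c"
proof -
  have "0 < (\<Sum>i\<in>V. (x i)\<^sup>2)" using assms by (intro sum_squares_pos) (simp add: eigenfunction_def)
  moreover have "0 \<le> c * (\<Sum>i\<in>V. (x i)\<^sup>2)"
    using quadratic_nonneg eigenfunction_quadratic[OF assms] by metis
  ultimately show ?thesis by (simp add: zero_le_mult_iff)
qed

text \<open>The unit sphere in the space of functions of sum zero is compact, so the Dirichlet form attains
  a minimum on it. The minimiser is critical and hence an eigenfunction, and the minimum is
  positive because the form vanishes only on constants.\<close>
lemma rayleigh_minimum_attained:
  assumes card: "2 \<le> card V"
  obtains c x where "eigenfunction G c x" "0 < c"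
    "\<And>u. (\<Sum>i\<in>V. u i) = 0 \<Longrightarrow> c * (\<Sum>i\<in>V. (u i)\<^sup>2) \<le> (\<Sum>i\<in>V. u i * lap G u i)"
proof -
  define Q where "Q = (\<lambda>u. \<Sum>i\<in>V. u i * lap G u i)"
  define N where "N = (\<lambda>u::'a \<Rightarrow> real. \<Sum>i\<in>V. (u i)\<^sup>2)"
  \<comment> \<open>Functions are pinned to 0 outside \<open>V\<close>, since the product topology takes all points
    of the type into account.\<close>
  define box :: "('a \<Rightarrow> real) set" where "box = PiE UNIV (\<lambda>i. if i \<in> V then {-1..1} else {0})"
  define K where "K = box \<inter> ({u. (\<Sum>i\<in>V. u i) = 0} \<inter> {u. N u = 1})"
  have "compactin (product_topology (\<lambda>_. euclidean) UNIV) box"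
    unfolding box_def compactin_PiE by auto
  then have "compact box" by (simp add: euclidean_product_topology)
  moreover have "closed {u::'a \<Rightarrow> real. (\<Sum>i\<in>V. u i) = 0}" "closed {u. N u = 1}"
    unfolding N_def by (intro closed_Collect_eq continuous_intros continuous_on_product_coordinates)+
  ultimately have "compact K" unfolding K_def by (intro compact_Int_closed closed_Int)
  \<comment> \<open>Every admissible direction is represented on the sphere.\<close>
  have scale: "\<exists>v\<in>K. \<forall>i\<in>V. v i = u i / sqrt (N u)"
    if sum0: "(\<Sum>i\<in>V. u i) = 0" and nz: "\<exists>i\<in>V. u i \<noteq> 0" for u :: "'a \<Rightarrow> real"
  proof -
    define v where "v = (\<lambda>i. if i \<in> V then u i / sqrt (N u) else 0)"
    have pos: "0 < N u" using sum_squares_pos nz by (simp add: N_def)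
    have "(\<Sum>i\<in>V. v i) = (\<Sum>i\<in>V. u i) / sqrt (N u)" by (simp add: v_def sum_divide_distrib)
    moreover have "(\<Sum>i\<in>V. (v i)\<^sup>2) = (\<Sum>i\<in>V. (u i)\<^sup>2 / N u)"
      using pos by (intro sum.cong) (simp_all add: v_def power_divide)
    then have "N v = N u / N u" by (simp add: sum_divide_distrib[symmetric] N_def)
    then have "N v = 1" using pos by simp
    moreover have "v \<in> box"
    proof -
      have "-1 \<le> v i \<and> v i \<le> 1" if "i \<in> V" for i
      proof -
        have "(v i)\<^sup>2 \<le> N v" unfolding N_def using finite_V that by (intro member_le_sum) auto
        then have "\<bar>v i\<bar> \<le> 1" using \<open>N v = 1\<close> by (simp only: abs_square_le_1)
        then show ?thesis by linarith
      qed
      moreover have "v i = 0" if "i \<notin> V" for i using that by (simp add: v_def)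
      ultimately show ?thesis by (simp add: box_def PiE_def Pi_def)
    qed
    ultimately show ?thesis using sum0 by (intro bexI[of _ v]) (auto simp: K_def v_def)
  qed
  obtain a where a: "a \<in> V" using V_nonempty by blast
  have "V \<noteq> {a}" using card by auto
  then obtain b where b: "b \<in> V" "b \<noteq> a" using a by blast
  \<comment> \<open>A difference of two point masses shows that the sphere is not empty.\<close>
  define h where "h = (\<lambda>i. if i = a then 1 else if i = b then -1 else 0 :: real)"
  have "(\<Sum>i\<in>V. h i) = (\<Sum>i\<in>{a, b}. h i)"
    using a b finite_V by (intro sum.mono_neutral_right) (auto simp: h_def)
  then have "(\<Sum>i\<in>V. h i) = 0" using b by (simp add: h_def)
  moreover have "\<exists>i\<in>V. h i \<noteq> 0" using a by (auto simp: h_def)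
  ultimately have "K \<noteq> {}" using scale by blast
  have "continuous_on K Q"
    unfolding Q_def lap_def
    by (intro continuous_intros continuous_on_subset[OF continuous_on_product_coordinates]) auto
  then obtain x where x: "x \<in> K" and min: "\<And>u. u \<in> K \<Longrightarrow> Q x \<le> Q u"
    using continuous_attains_inf[OF \<open>compact K\<close> \<open>K \<noteq> {}\<close>] by blast
  define c where "c = Q x"
  have Nx: "N x = 1" and sumx: "(\<Sum>i\<in>V. x i) = 0" using x by (simp_all add: K_def)
  have rayleigh: "c * N u \<le> Q u" if sum0: "(\<Sum>i\<in>V. u i) = 0" for u
  proof (cases "\<exists>i\<in>V. u i \<noteq> 0")
    case False
    then show ?thesis by (simp add: N_def Q_def)
  next
    case True
    then have pos: "0 < N u" using sum_squares_pos by (simp add: N_def)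
    obtain v where v: "v \<in> K" "\<forall>i\<in>V. v i = u i / sqrt (N u)" using scale[OF sum0 True] by blast
    have "Q v = (\<Sum>i\<in>V. u i * lap G u i / N u)"
      unfolding Q_def
    proof (rule sum.cong[OF refl])
      fix i assume i: "i \<in> V"
      have "lap G v i = lap G (\<lambda>i. 1 / sqrt (N u) * u i + 0 * u i) i"
        using v(2) i by (intro lap_cong) simp_all
      then have "lap G v i = lap G u i / sqrt (N u)" unfolding lap_linear by simp
      then show "v i * lap G v i = u i * lap G u i / N u" using v(2) i pos by simp
    qed
    then have "Q v = Q u / N u" by (simp add: Q_def sum_divide_distrib)
    then have "Q x \<le> Q u / N u" using min[OF v(1)] by simp
    then show ?thesis using pos by (simp add: c_def pos_le_divide_eq)
  qed
  \<comment> \<open>First variation at the minimiser in an arbitrary direction of sum zero.\<close>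
  have crit: "(\<Sum>i\<in>V. h i * (lap G x i - c * x i)) = 0" if sum0: "(\<Sum>i\<in>V. h i) = 0" for h
  proof -
    define B where "B = (\<Sum>i\<in>V. h i * (lap G x i - c * x i))"
    define C where "C = Q h - c * N h"
    have "0 \<le> 2 * t * B + t\<^sup>2 * C" for t
    proof -
      define u where "u = (\<lambda>i. 1 * x i + t * h i)"
      have "(\<Sum>i\<in>V. u i) = (\<Sum>i\<in>V. x i) + t * (\<Sum>i\<in>V. h i)"
        by (simp add: u_def sum.distrib sum_distrib_left)
      then have "c * N u \<le> Q u" using rayleigh sumx sum0 by simp
      moreover have "Q u = Q x + t * (\<Sum>i\<in>V. x i * lap G h i) + t * (\<Sum>i\<in>V. h i * lap G x i) + t\<^sup>2 * Q h"
        unfolding Q_def u_def lap_linear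
        by (simp add: algebra_simps sum.distrib sum_distrib_left power2_eq_square)
      moreover have "(\<Sum>i\<in>V. x i * lap G h i) = (\<Sum>i\<in>V. h i * lap G x i)" by (rule lap_self_adjoint)
      moreover have "N u = N x + 2 * t * (\<Sum>i\<in>V. h i * x i) + t\<^sup>2 * N h"
        unfolding N_def u_def
        by (simp add: algebra_simps sum.distrib sum_distrib_left power2_eq_square)
      moreover have "(\<Sum>i\<in>V. h i * lap G x i) = B + c * (\<Sum>i\<in>V. h i * x i)"
        unfolding B_def by (simp add: algebra_simps sum_subtractf sum_distrib_left)
      ultimately show ?thesis using Nx by (simp add: C_def c_def algebra_simps)
    qed
    note pos = this
    have "B = 0"
    proof (rule ccontr)
      assume "B \<noteq> 0"
      \<comment> \<open>The step is so short that the linear term, which can be made negative, outweighs the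
        quadratic one.\<close>
      define t where "t = - B / (\<bar>C\<bar> + 1)"
      have "t\<^sup>2 * C \<le> t\<^sup>2 * (\<bar>C\<bar> + 1)" by (intro mult_left_mono) auto
      also have "\<dots> = - (t * B)" by (simp add: t_def power2_eq_square)
      finally have "2 * t * B + t\<^sup>2 * C \<le> t * B" by linarith
      moreover have "t * B < 0" using \<open>B \<noteq> 0\<close>
        by (simp add: t_def field_simps power2_eq_square[symmetric] add_pos_nonneg)
      ultimately show False using pos[of t] by linarith
    qed
    then show ?thesis by (simp add: B_def)
  qed
  have "(\<Sum>i\<in>V. lap G x i - c * x i) = 0"
    by (simp add: sum_subtractf sum_lap sum_distrib_left[symmetric] sumx)
  then have "(\<Sum>i\<in>V. (lap G x i - c * x i)\<^sup>2) = 0"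
    using crit by (simp add: power2_eq_square)
  then have "\<forall>i\<in>V. lap G x i = c * x i"
    using finite_V by (simp add: sum_nonneg_eq_0_iff)
  moreover have nz: "\<exists>i\<in>V. x i \<noteq> 0"
  proof (rule ccontr)
    assume "\<not> ?thesis"
    then have "N x = 0" by (simp add: N_def)
    then show False using Nx by simp
  qed
  ultimately have eig: "eigenfunction G c x" by (simp add: eigenfunction_def)
  have "c \<noteq> 0"
  proof
    assume "c = 0"
    then have const: "x i = x a" if "i \<in> V" for i
      using quadratic_zero_imp_constant[of x i a] that a by (simp add: c_def Q_def)
    then have "(\<Sum>i\<in>V. x i) = card V * x a" by simp
    then have "x a = 0" using sumx card by simp
    then show False using const nz by auto
  qed
  then have "0 < c" using eigenvalue_nonneg[OF eig] by simp
  show thesis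
    by (rule that[OF eig \<open>0 < c\<close>]) (use rayleigh in \<open>simp add: Q_def N_def\<close>)
qed

end

section \<open>The algebraic connectivity as a Rayleigh minimum\<close>

text \<open>Adding all columns of the characteristic matrix to the first one replaces that column by the
  indeterminate times the all-ones column, since the rows of \<open>A\<close> sum to zero. The characteristic
  polynomial is thus the indeterminate times \<open>det M\<close>, where \<open>M\<close> has the all-ones column instead.
  At 0 the determinant of \<open>M\<close> does not vanish: summing the rows of a kernel vector's
  equations shows that its first entry is zero, and then its other entries form a vector in the
  kernel of \<open>A\<close> that vanishes at one place, so everywhere, as that kernel consists of constant vectors.\<close>
lemma char_poly_order_zero:
  fixes A :: "real mat"
  assumes A: "A \<in> carrier_mat n n" and n: "0 < n"
    and rows: "\<And>i. i < n \<Longrightarrow> (\<Sum>j<n. A $$ (i, j)) = 0"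
    and cols: "\<And>j. j < n \<Longrightarrow> (\<Sum>i<n. A $$ (i, j)) = 0"
    and ker: "\<And>v i. v \<in> carrier_vec n \<Longrightarrow> A *\<^sub>v v = 0\<^sub>v n \<Longrightarrow> i < n \<Longrightarrow> v $ i = v $ 0"
  shows "order 0 (char_poly A) = 1"
proof -
  define C where "C = char_poly_matrix A"
  have C: "C \<in> carrier_mat n n" using A by (simp add: C_def)
  have Cij: "C $$ (i, j) = (if i = j then [:- A $$ (i, j), 1:] else [:- A $$ (i, j):])"
    if "i < n" "j < n" for i j
    using that A by (auto simp: C_def char_poly_matrix_def)
  \<comment> \<open>Multiplication by \<open>E\<close> adds all columns to the first one; multiplication by \<open>D\<close> scales the
    first column by the indeterminate.\<close>
  define E :: "real poly mat" where "E = mat n n (\<lambda>(i, j). if j = 0 \<or> i = j then 1 else 0)"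
  define D :: "real poly mat" where
    "D = mat n n (\<lambda>(i, j). if i = j then (if i = 0 then [:0, 1:] else 1) else 0)"
  define M where "M = mat n n (\<lambda>(i, j). if j = 0 then 1 else C $$ (i, j))"
  have carr: "E \<in> carrier_mat n n" "D \<in> carrier_mat n n" "M \<in> carrier_mat n n"
    by (simp_all add: E_def D_def M_def)
  have diag: "prod_list (diag_mat X) = X $$ (0, 0)"
    if "X \<in> carrier_mat n n" "\<And>i. 0 < i \<Longrightarrow> i < n \<Longrightarrow> X $$ (i, i) = 1" for X :: "real poly mat"
  proof -
    obtain m where m: "n = Suc m" using n by (cases n) auto
    have "diag_mat X = X $$ (0, 0) # map (\<lambda>i. X $$ (Suc i, Suc i)) [0..<m]"
      using that(1) m by (simp add: diag_mat_def upt_conv_Cons map_Suc_upt[symmetric] del: upt_Suc)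
    moreover have "map (\<lambda>i. X $$ (Suc i, Suc i)) [0..<m] = map (\<lambda>i. 1) [0..<m]"
      using that(2) m by simp
    ultimately show ?thesis by (simp add: map_replicate_const)
  qed
  have "det E = E $$ (0, 0)"
    using det_lower_triangular[OF _ carr(1)] diag[OF carr(1)] by (simp add: E_def)
  then have "det E = 1" using n by (simp add: E_def)
  have "det D = D $$ (0, 0)"
    using det_lower_triangular[OF _ carr(2)] diag[OF carr(2)] by (simp add: D_def)
  then have "det D = [:0, 1:]" using n by (simp add: D_def)
  have "C * E = M * D"
  proof (rule eq_matI)
    fix i j assume "i < dim_row (M * D)" "j < dim_col (M * D)"
    then have ij: "i < n" "j < n" using carr by auto
    have MD: "(M * D) $$ (i, j) = M $$ (i, j) * (if j = 0 then [:0, 1:] else 1)"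
    proof -
      have "(M * D) $$ (i, j) = (\<Sum>k<n. M $$ (i, k) * D $$ (k, j))"
        using ij carr by (simp add: scalar_prod_def lessThan_atLeast0)
      also have "\<dots> = (\<Sum>k\<in>{j}. M $$ (i, k) * D $$ (k, j))"
        using ij by (intro sum.mono_neutral_right) (auto simp: D_def)
      finally show ?thesis using ij by (simp add: D_def)
    qed
    have CE: "(C * E) $$ (i, j) = (\<Sum>k<n. C $$ (i, k) * E $$ (k, j))"
      using ij carr C by (simp add: scalar_prod_def lessThan_atLeast0)
    show "(C * E) $$ (i, j) = (M * D) $$ (i, j)"
    proof (cases "j = 0")
      case True
      have "(C * E) $$ (i, j) = (\<Sum>k<n. C $$ (i, k))"
        unfolding CE using True n by (intro sum.cong) (auto simp: E_def)
      also have "\<dots> = (\<Sum>k<n. (if k = i then [:0, 1:] else 0) + [:- A $$ (i, k):])"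
        using ij by (intro sum.cong) (auto simp: Cij)
      also have "\<dots> = [:0, 1:] + (\<Sum>k<n. [:- A $$ (i, k):])"
        using ij by (simp add: sum.distrib)
      also have "(\<Sum>k<n. [:- A $$ (i, k):]) = [:\<Sum>k<n. - A $$ (i, k):]"
        by (induction n) auto
      also have "\<dots> = 0" using rows[OF ij(1)] by (simp add: sum_negf)
      finally show ?thesis unfolding MD using True ij by (simp add: M_def)
    next
      case False
      have "(C * E) $$ (i, j) = (\<Sum>k\<in>{j}. C $$ (i, k) * E $$ (k, j))"
        unfolding CE using ij False by (intro sum.mono_neutral_right) (auto simp: E_def)
      then show ?thesis unfolding MD using False ij by (simp add: E_def M_def)
    qed
  qed (use C carr in auto)
  then have "char_poly A = [:0, 1:] * det M"
    using \<open>det E = 1\<close> \<open>det D = [:0, 1:]\<close> det_mult[OF C carr(1)] det_mult[OF carr(3,2)] by (simp add: char_poly_def C_def)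
  moreover have "poly (det M) 0 \<noteq> 0"
  proof
    define M0 where "M0 = mat n n (\<lambda>(i, j). if j = 0 then 1 else - A $$ (i, j))"
    have M0: "M0 \<in> carrier_mat n n" by (simp add: M0_def)
    assume "poly (det M) 0 = 0"
    moreover have "poly (det M) 0 = det M0"
      by (rule poly_det_cong[OF M0 carr(3)]) (auto simp: M_def M0_def Cij)
    ultimately have "det M0 = 0" by simp
    then obtain v where v: "v \<in> carrier_vec n" "v \<noteq> 0\<^sub>v n" "M0 *\<^sub>v v = 0\<^sub>v n"
      using det_0_iff_vec_prod_zero_field[OF M0] by blast
    define y where "y = vec n (\<lambda>i. if i = 0 then 0 else v $ i)"
    have row: "(\<Sum>j<n. A $$ (i, j) * y $ j) = v $ 0" if i: "i < n" for i
    proof -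
      have "0 = (M0 *\<^sub>v v) $ i" using v(3) i by simp
      also have "\<dots> = (\<Sum>j<n. M0 $$ (i, j) * v $ j)"
        using i v(1) M0 by (auto simp: scalar_prod_def lessThan_atLeast0)
      also have "\<dots> = (\<Sum>j<n. (if j = 0 then v $ 0 else 0) - A $$ (i, j) * y $ j)"
        using i by (intro sum.cong) (auto simp: M0_def y_def)
      also have "\<dots> = v $ 0 - (\<Sum>j<n. A $$ (i, j) * y $ j)"
        using n by (simp add: sum_subtractf)
      finally show ?thesis by simp
    qed
    have "(\<Sum>i<n. \<Sum>j<n. A $$ (i, j) * y $ j) = (\<Sum>j<n. (\<Sum>i<n. A $$ (i, j)) * y $ j)"
      by (subst sum.swap) (simp add: sum_distrib_right)
    then have "real n * v $ 0 = 0" using row cols by simp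
    then have v0: "v $ 0 = 0" using n by simp
    have "A *\<^sub>v y = 0\<^sub>v n"
      using A row v0 by (intro eq_vecI) (auto simp: scalar_prod_def lessThan_atLeast0 y_def)
    then have "y $ i = 0" if "i < n" for i
      using ker[of y i] that n by (simp add: y_def)
    then have "v $ i = 0" if "i < n" for i
      using that v0 by (cases "i = 0") (force simp: y_def)+
    then have "v = 0\<^sub>v n" using v(1) by (intro eq_vecI) auto
    then show False using v(2) by simp
  qed
  moreover from this have "det M \<noteq> 0" by auto
  then have "[:0, 1:] * det M \<noteq> 0" by simp
  then have "order 0 ([:0, 1:] * det M) = order 0 [:0, 1::real:] + order 0 (det M)"
    by (rule order_mult)
  ultimately show ?thesis
    using order_power_n_n[of "0::real" 1] by (simp add: order_0I)
qed

context connected_network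
begin

lemma vertex_list: "distinct (vertex_list G)" "set (vertex_list G) = V"
proof -
  have "\<exists>vs. distinct vs \<and> set vs = V" using finite_distinct_list[OF finite_V] by blast
  from someI_ex[OF this] show "distinct (vertex_list G)" "set (vertex_list G) = V"
    by (simp_all add: vertex_list_def)
qed

lemma length_vertex_list: "length (vertex_list G) = card V"
  using distinct_card[OF vertex_list(1)] vertex_list(2) by simp

lemma vertex_list_nth: "i < card V \<Longrightarrow> vertex_list G ! i \<in> V"
  using vertex_list(2) length_vertex_list nth_mem by metis

lemma vertex_list_onto:
  assumes "u \<in> V" obtains i where "i < card V" "vertex_list G ! i = u"
  using assms vertex_list(2) length_vertex_list by (metis in_set_conv_nth)

lemma sum_vertex_list: "(\<Sum>j<card V. f (vertex_list G ! j)) = (\<Sum>u\<in>V. f u)"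
proof (rule sum.reindex_bij_betw)
  show "bij_betw ((!) (vertex_list G)) {..<card V} V"
    using bij_betw_nth[OF vertex_list(1)] vertex_list(2) length_vertex_list by simp
qed

lemma laplacian_entry_eq:
  "laplacian_entry G i k = (if i = k then \<Sum>u\<in>V. W i u else 0) - W i k"
proof -
  have "neighbors G i \<subseteq> V"
    using edge_endpoints(1)[OF simple] by (auto simp: neighbors_def)
  then have "(\<Sum>u\<in>neighbors G i. wt G {i, u}) = (\<Sum>u\<in>V. W i u)"
    using finite_V
    by (intro sum.mono_neutral_cong_left)
      (auto simp: neighbors_def edge_weight_def insert_commute)
  moreover have "W i i = 0" by (rule W_diag)
  ultimately show ?thesis
    by (cases "i = k") (simp add: laplacian_entry_def, simp add: laplacian_entry_def edge_weight_def)
qed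

lemma laplacian_entry_commute: "laplacian_entry G i k = laplacian_entry G k i"
  by (simp add: laplacian_entry_eq edge_weight_commute[of G i k])

lemma sum_laplacian_entry:
  assumes "i \<in> V" shows "(\<Sum>u\<in>V. laplacian_entry G i u * x u) = lap G x i"
proof -
  have "(\<Sum>u\<in>V. laplacian_entry G i u * x u)
      = (\<Sum>u\<in>V. (if i = u then (\<Sum>k\<in>V. W i k) * x i else 0) - W i u * x u)"
    by (intro sum.cong) (auto simp: laplacian_entry_eq algebra_simps)
  also have "\<dots> = (\<Sum>k\<in>V. W i k) * x i - (\<Sum>u\<in>V. W i u * x u)"
    using assms finite_V by (simp add: sum_subtractf)
  finally show ?thesis
    by (simp add: lap_def right_diff_distrib sum_subtractf sum_distrib_right)
qed

lemma laplacian_carrier: "laplacian G \<in> carrier_mat (card V) (card V)"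
  by (simp add: laplacian_def)

lemma vec_of_carrier: "vec_of G x \<in> carrier_vec (card V)"
  by (simp add: vec_of_def)

lemma laplacian_mult_vec: "laplacian G *\<^sub>v vec_of G x = vec_of G (lap G x)"
proof (rule eq_vecI)
  fix i assume "i < dim_vec (vec_of G (lap G x))"
  then have i: "i < card V" by (simp add: vec_of_def)
  have "(laplacian G *\<^sub>v vec_of G x) $ i
      = (\<Sum>j<card V. laplacian_entry G (vertex_list G ! i) (vertex_list G ! j) * x (vertex_list G ! j))"
    using i by (simp add: laplacian_def vec_of_def scalar_prod_def lessThan_atLeast0)
  also have "\<dots> = lap G x (vertex_list G ! i)"
    using sum_vertex_list[of "\<lambda>u. laplacian_entry G (vertex_list G ! i) u * x u"]
      sum_laplacian_entry[OF vertex_list_nth[OF i]] by simp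
  finally show "(laplacian G *\<^sub>v vec_of G x) $ i = vec_of G (lap G x) $ i"
    using i by (simp add: vec_of_def)
qed (simp add: laplacian_def vec_of_def)

lemma vec_of_eq_iff: "vec_of G x = vec_of G y \<longleftrightarrow> (\<forall>i\<in>V. x i = y i)"
proof
  assume eq: "vec_of G x = vec_of G y"
  show "\<forall>i\<in>V. x i = y i"
  proof
    fix u assume "u \<in> V"
    then obtain i where i: "i < card V" "vertex_list G ! i = u" by (rule vertex_list_onto)
    have "vec_of G x $ i = vec_of G y $ i" using eq by simp
    then show "x u = y u" using i by (simp add: vec_of_def)
  qed
next
  assume "\<forall>i\<in>V. x i = y i"
  then show "vec_of G x = vec_of G y"
    unfolding vec_of_def using vertex_list_nth by (intro eq_vecI) auto
qed

lemma eigenvector_iff: "eigenvector (laplacian G) (vec_of G x) c \<longleftrightarrow> eigenfunction G c x"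
proof -
  have zero: "0\<^sub>v (card V) = vec_of G (\<lambda>_. 0)" and smult: "c \<cdot>\<^sub>v vec_of G x = vec_of G (\<lambda>i. c * x i)"
    by (auto simp: vec_of_def)
  have dim: "dim_row (laplacian G) = card V" by (simp add: laplacian_def)
  show ?thesis
    unfolding eigenvector_def eigenfunction_def dim zero smult laplacian_mult_vec vec_of_eq_iff
    by (simp add: vec_of_carrier)
qed

lemma vec_of_surj:
  assumes "v \<in> carrier_vec (card V)" obtains x where "v = vec_of G x"
proof -
  define idx where "idx = (\<lambda>u. SOME i. i < card V \<and> vertex_list G ! i = u)"
  have "idx (vertex_list G ! i) = i" if "i < card V" for i
  proof -
    have "idx (vertex_list G ! i) < card V \<and> vertex_list G ! idx (vertex_list G ! i) = vertex_list G ! i"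
      unfolding idx_def by (rule someI[of _ i]) (simp add: that)
    then show ?thesis
      using that vertex_list(1) length_vertex_list nth_eq_iff_index_eq by metis
  qed
  then have "v = vec_of G (\<lambda>u. v $ idx u)"
    using assms by (intro eq_vecI) (auto simp: vec_of_def)
  then show thesis by (rule that)
qed

lemma eigenvalue_iff: "eigenvalue (laplacian G) c \<longleftrightarrow> (\<exists>x. eigenfunction G c x)"
proof
  assume "eigenvalue (laplacian G) c"
  then obtain v where v: "eigenvector (laplacian G) v c" by (auto simp: eigenvalue_def)
  then have "v \<in> carrier_vec (card V)" by (simp add: eigenvector_def laplacian_def)
  then obtain x where "v = vec_of G x" by (rule vec_of_surj)
  then show "\<exists>x. eigenfunction G c x" using v eigenvector_iff by auto
next
  assume "\<exists>x. eigenfunction G c x"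
  then show "eigenvalue (laplacian G) c" using eigenvector_iff by (auto simp: eigenvalue_def)
qed

lemma laplacian_order_zero: "order 0 (char_poly (laplacian G)) = 1"
proof (rule char_poly_order_zero[OF laplacian_carrier])
  let ?v = "\<lambda>i. vertex_list G ! i"
  show "0 < card V" using finite_V V_nonempty by (simp add: card_gt_0_iff)
  have rows: "(\<Sum>j<card V. laplacian_entry G (?v i) (?v j)) = 0" if "i < card V" for i
    using sum_vertex_list[of "\<lambda>u. laplacian_entry G (?v i) u * 1"]
      sum_laplacian_entry[OF vertex_list_nth[OF that], of "\<lambda>_. 1"] by (simp add: lap_const)
  show "(\<Sum>j<card V. laplacian G $$ (i, j)) = 0" if "i < card V" for i
    using rows[OF that] that by (simp add: laplacian_def)
  show "(\<Sum>i<card V. laplacian G $$ (i, j)) = 0" if "j < card V" for j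
    using rows[OF that] that by (simp add: laplacian_def laplacian_entry_commute[of _ "?v j"])
  show "v $ i = v $ 0"
    if v: "v \<in> carrier_vec (card V)" "laplacian G *\<^sub>v v = 0\<^sub>v (card V)" and i: "i < card V" for v i
  proof -
    obtain x where x: "v = vec_of G x" using v(1) by (rule vec_of_surj)
    have "vec_of G (lap G x) = vec_of G (\<lambda>_. 0)"
      using v(2) unfolding x laplacian_mult_vec by (auto simp: vec_of_def)
    then have "\<forall>i\<in>V. lap G x i = 0" unfolding vec_of_eq_iff .
    then have "x (?v i) = x (?v 0)"
      using i vertex_list_nth[of i] vertex_list_nth[of 0]
      by (intro lap_zero_imp_constant) auto
    then show ?thesis using i by (auto simp: x vec_of_def)
  qed
qed

text \<open>Zero is a simple root and every other root is positive, so the sorted list of roots starts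
  with a single zero and its second entry is the least positive eigenvalue.\<close>
lemma algebraic_connectivity_eqI:
  assumes c: "0 < c" "eigenfunction G c x"
    and least: "\<And>d y. eigenfunction G d y \<Longrightarrow> 0 < d \<Longrightarrow> c \<le> d"
  shows "algebraic_connectivity G = c"
proof -
  define p where "p = char_poly (laplacian G)"
  have p: "p \<noteq> 0" using degree_monic_char_poly[OF laplacian_carrier] by (auto simp: p_def)
  have root: "d \<in># proots p \<longleftrightarrow> (\<exists>y. eigenfunction G d y)" for d
    using p eigenvalue_root_char_poly[OF laplacian_carrier, of d]
    by (simp add: p_def eigenvalue_iff)
  define M where "M = proots p - {#0#}"
  have count0: "count (proots p) 0 = 1"
    using laplacian_order_zero p by (simp add: p_def)
  have "0 \<in># proots p" by (rule count_inI) (simp add: count0)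
  then have pM: "proots p = add_mset 0 M" by (simp add: M_def)
  then have "0 \<notin># M" using count0 by (metis count_add_mset count_eq_zero_iff One_nat_def Suc_inject)
  have "c \<in># M" using root[of c] c pM by auto
  have geM: "c \<le> d" if "d \<in># M" for d
  proof -
    have "d \<in># proots p" using that by (simp add: pM)
    then obtain y where y: "eigenfunction G d y" using root by blast
    have "d \<noteq> 0" using that \<open>0 \<notin># M\<close> by auto
    then show ?thesis using least[OF y] eigenvalue_nonneg[OF y] by simp
  qed
  define ms where "ms = sorted_list_of_multiset M"
  have ms: "sorted ms" "set ms = set_mset M" by (simp_all add: ms_def)
  then obtain d ds where dds: "ms = d # ds" using \<open>c \<in># M\<close> by (cases ms) auto
  then have "d = c" using ms geM[of d] \<open>c \<in># M\<close> by force
  have "sorted_list_of_multiset (proots p) = insort 0 ms" by (simp add: pM ms_def)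
  also have "\<dots> = 0 # c # ds" using dds \<open>d = c\<close> c(1) by simp
  finally show ?thesis by (simp add: algebraic_connectivity_def p_def)
qed

text \<open>An eigenfunction for a positive eigenvalue has sum zero, so the Rayleigh minimum bounds all
  positive eigenvalues from below, and it is one of them.\<close>
lemma algebraic_connectivity_spectral:
  assumes "2 \<le> card V"
  shows "0 < algebraic_connectivity G" (is ?pos)
    and "\<exists>x. eigenfunction G (algebraic_connectivity G) x" (is ?ex)
    and "(\<Sum>i\<in>V. u i) = 0 \<Longrightarrow>
      algebraic_connectivity G * (\<Sum>i\<in>V. (u i)\<^sup>2) \<le> (\<Sum>i\<in>V. u i * lap G u i)"
proof -
  obtain c x where c: "eigenfunction G c x" "0 < c"
    and ray: "\<And>u. (\<Sum>i\<in>V. u i) = 0 \<Longrightarrow> c * (\<Sum>i\<in>V. (u i)\<^sup>2) \<le> (\<Sum>i\<in>V. u i * lap G u i)"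
    using rayleigh_minimum_attained[OF assms] by blast
  have "algebraic_connectivity G = c"
  proof (rule algebraic_connectivity_eqI[OF c(2,1)])
    fix d y assume y: "eigenfunction G d y" "0 < d"
    then have "c * (\<Sum>i\<in>V. (y i)\<^sup>2) \<le> d * (\<Sum>i\<in>V. (y i)\<^sup>2)"
      using ray[of y] eigenfunction_sum_zero[OF y(1)] eigenfunction_quadratic[OF y(1)] by simp
    moreover have "0 < (\<Sum>i\<in>V. (y i)\<^sup>2)"
      using y(1) by (intro sum_squares_pos) (simp add: eigenfunction_def)
    ultimately show "c \<le> d" by simp
  qed
  then show ?pos ?ex "(\<Sum>i\<in>V. u i) = 0 \<Longrightarrow>
      algebraic_connectivity G * (\<Sum>i\<in>V. (u i)\<^sup>2) \<le> (\<Sum>i\<in>V. u i * lap G u i)"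
    using c ray by auto
qed

lemma fiedler_vector_iff:
  "fiedler_vector G x \<longleftrightarrow>
     2 \<le> card V \<and> x \<in> extensional V \<and> eigenfunction G (algebraic_connectivity G) x"
  by (simp add: fiedler_vector_def eigenvector_iff)

lemma algebraic_connectivity_le_eigenvalue:
  assumes "2 \<le> card V" "eigenfunction G c x" "0 < c"
  shows "algebraic_connectivity G \<le> c"
proof -
  have "algebraic_connectivity G * (\<Sum>i\<in>V. (x i)\<^sup>2) \<le> c * (\<Sum>i\<in>V. (x i)\<^sup>2)"
    using algebraic_connectivity_spectral(3)[OF assms(1), of x] assms(3)
      eigenfunction_sum_zero[OF assms(2)] eigenfunction_quadratic[OF assms(2)] by simp
  moreover have "0 < (\<Sum>i\<in>V. (x i)\<^sup>2)"
    using assms(2) by (intro sum_squares_pos) (simp add: eigenfunction_def)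
  ultimately show ?thesis by simp
qed

end

section \<open>Signs of eigenfunctions\<close>

context connected_network
begin

text \<open>Writing a function as a multiple \<open>d * x\<close> of an eigenfunction turns its Dirichlet form, less
  \<open>c\<close> times its square norm, into a sum over the edges in which each term has the sign of
  \<open>x i * x k\<close> or vanishes. Both sign arguments below rest on this identity.\<close>
lemma rayleigh_of_product:
  assumes x: "\<And>i. i \<in> V \<Longrightarrow> lap G x i = c * x i"
  shows "(\<Sum>i\<in>V. d i * x i * lap G (\<lambda>i. d i * x i) i)
    = c * (\<Sum>i\<in>V. (d i * x i)\<^sup>2)
      + (\<Sum>i\<in>V. \<Sum>k\<in>V. W i k * (x i * x k) * (d i - d k)\<^sup>2) / 2"
proof -
  define f where "f = (\<lambda>i k. W i k * (x i * x k) * (d i * (d i - d k)))"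
  have "(\<Sum>i\<in>V. d i * x i * lap G (\<lambda>i. d i * x i) i) - (\<Sum>i\<in>V. (d i)\<^sup>2 * x i * lap G x i)
      = (\<Sum>i\<in>V. \<Sum>k\<in>V. f i k)"
    unfolding lap_def sum_distrib_left sum_subtractf[symmetric] f_def
    by (intro sum.cong refl) (simp add: algebra_simps power2_eq_square)
  also have "\<dots> = (\<Sum>i\<in>V. \<Sum>k\<in>V. (f i k + f k i) / 2)" by (rule sum_swap_symmetric)
  also have "\<dots> = (\<Sum>i\<in>V. \<Sum>k\<in>V. W i k * (x i * x k) * (d i - d k)\<^sup>2 / 2)"
  proof (intro sum.cong refl)
    fix i k
    show "(f i k + f k i) / 2 = W i k * (x i * x k) * (d i - d k)\<^sup>2 / 2"
      by (simp add: f_def edge_weight_commute[of G k i] algebra_simps power2_eq_square)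
  qed
  also have "\<dots> = (\<Sum>i\<in>V. \<Sum>k\<in>V. W i k * (x i * x k) * (d i - d k)\<^sup>2) / 2"
    by (simp add: sum_divide_distrib)
  finally have "(\<Sum>i\<in>V. d i * x i * lap G (\<lambda>i. d i * x i) i) - (\<Sum>i\<in>V. (d i)\<^sup>2 * x i * lap G x i)
    = (\<Sum>i\<in>V. \<Sum>k\<in>V. W i k * (x i * x k) * (d i - d k)\<^sup>2) / 2" .
  moreover have "(\<Sum>i\<in>V. (d i)\<^sup>2 * x i * lap G x i) = c * (\<Sum>i\<in>V. (d i * x i)\<^sup>2)"
    unfolding sum_distrib_left using x
    by (intro sum.cong refl) (simp add: algebra_simps power2_eq_square)
  ultimately show ?thesis by simp
qed

lemma sign_change_edge_exists:
  fixes x :: "'a \<Rightarrow> real"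
  assumes sum0: "(\<Sum>i\<in>V. x i) = 0" and nz: "\<And>i. i \<in> V \<Longrightarrow> x i \<noteq> 0"
  shows "\<exists>a b. {a, b} \<in> edges G \<and> x a * x b < 0"
proof (rule ccontr)
  assume none: "\<not> ?thesis"
  obtain u where u: "u \<in> V" using V_nonempty by blast
  have pos: "0 < x u * x v" if "v \<in> V" for v
  proof (rule connected_propagate[of u "\<lambda>v. 0 < x u * x v", OF u _ _ that])
    show "0 < x u * x u" using nz[OF u] not_real_square_gt_zero[of "x u"] by blast
    fix i k assume ik: "{i, k} \<in> edges G" "0 < x u * x i"
    have "x i * x k \<noteq> 0" using nz edge_endpoints[OF simple ik(1)] by simp
    then have "0 < x i * x k" using none ik(1) by (metis linorder_neqE_linordered_idom)
    then show "0 < x u * x k" using ik(2) by (auto simp: zero_less_mult_iff)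
  qed
  have "0 < (\<Sum>v\<in>V. x u * x v)" using pos finite_V V_nonempty by (intro sum_pos)
  then show False using sum0 by (simp add: sum_distrib_left[symmetric])
qed

text \<open>Every function that vanishes at \<open>r\<close> is a multiple \<open>d * x\<close>, and as no edge has a negative
  product, its Rayleigh quotient is at least \<open>c\<close>. Such functions form a hyperplane, which leaves
  room for a single eigenvalue below \<open>c\<close>, namely 0. To see this directly, an eigenfunction \<open>y\<close>
  for the algebraic connectivity is shifted by the constant \<open>y r\<close>: the Dirichlet form stays the same,
  while the norm does not decrease because \<open>y\<close> has sum zero.\<close>
lemma eigenvalue_le_connectivity:
  assumes card: "2 \<le> card V" and eig: "eigenfunction G c x" and c: "0 < c"
    and r: "r \<in> V" "x r = 0" and nz: "\<And>i. i \<in> V \<Longrightarrow> i \<noteq> r \<Longrightarrow> x i \<noteq> 0"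
    and sign: "\<And>i k. {i, k} \<in> edges G \<Longrightarrow> 0 \<le> x i * x k"
  shows "c \<le> algebraic_connectivity G"
proof -
  define m where "m = algebraic_connectivity G"
  have m: "0 < m" using algebraic_connectivity_spectral(1)[OF card] by (simp add: m_def)
  obtain y where y: "eigenfunction G m y"
    using algebraic_connectivity_spectral(2)[OF card] by (auto simp: m_def)
  define z where "z = (\<lambda>i. y i - y r)"
  define d where "d = (\<lambda>i. z i / x i)"
  \<comment> \<open>At \<open>r\<close> the quotient \<open>d r\<close> is 0 / 0, and both sides of the equation are zero.\<close>
  have dz: "d i * x i = z i" if "i \<in> V" for i
    using nz[OF that] r by (cases "i = r") (auto simp: d_def z_def)
  have sumy: "(\<Sum>i\<in>V. y i) = 0" using eigenfunction_sum_zero[OF y] m by simp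
  have "0 \<le> (\<Sum>i\<in>V. \<Sum>k\<in>V. W i k * (x i * x k) * (d i - d k)\<^sup>2)"
    using sign less_imp_le[OF wt_pos] by (intro sum_nonneg) (simp add: edge_weight_def)
  then have "c * (\<Sum>i\<in>V. (d i * x i)\<^sup>2) \<le> (\<Sum>i\<in>V. d i * x i * lap G (\<lambda>i. d i * x i) i)"
    using rayleigh_of_product[of x c d] eig by (simp add: eigenfunction_def)
  moreover have "(\<Sum>i\<in>V. (d i * x i)\<^sup>2) = (\<Sum>i\<in>V. (z i)\<^sup>2)" using dz by simp
  moreover have "(\<Sum>i\<in>V. d i * x i * lap G (\<lambda>i. d i * x i) i) = (\<Sum>i\<in>V. z i * lap G z i)"
    using dz by (intro sum.cong refl) (simp add: lap_def)
  moreover have "(\<Sum>i\<in>V. z i * lap G z i) = (\<Sum>i\<in>V. y i * lap G y i) - y r * (\<Sum>i\<in>V. lap G y i)"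
    by (simp add: z_def lap_shift left_diff_distrib sum_subtractf sum_distrib_left)
  moreover have "(\<Sum>i\<in>V. y i * lap G y i) = m * (\<Sum>i\<in>V. (y i)\<^sup>2)"
    by (rule eigenfunction_quadratic[OF y])
  ultimately have le: "c * (\<Sum>i\<in>V. (z i)\<^sup>2) \<le> m * (\<Sum>i\<in>V. (y i)\<^sup>2)"
    by (simp add: sum_lap)
  have "(\<Sum>i\<in>V. (z i)\<^sup>2) = (\<Sum>i\<in>V. (y i)\<^sup>2) - 2 * y r * (\<Sum>i\<in>V. y i) + card V * (y r)\<^sup>2"
    by (simp add: z_def power2_diff sum.distrib sum_subtractf sum_distrib_left mult_ac)
  then have "(\<Sum>i\<in>V. (y i)\<^sup>2) \<le> (\<Sum>i\<in>V. (z i)\<^sup>2)" using sumy by simp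
  then have "c * (\<Sum>i\<in>V. (y i)\<^sup>2) \<le> m * (\<Sum>i\<in>V. (y i)\<^sup>2)"
    using le c mult_left_mono[of _ _ c] by (meson less_imp_le order_trans)
  moreover have "0 < (\<Sum>i\<in>V. (y i)\<^sup>2)"
    using y by (intro sum_squares_pos) (simp add: eigenfunction_def)
  ultimately show ?thesis by (simp add: m_def)
qed

end

section \<open>Eigenfunctions on trees\<close>

lemma tree_imp_network: "weighted_tree G \<Longrightarrow> connected_network G"
  by unfold_locales (auto simp: weighted_tree_def dest: PiE_mem)

text \<open>A discrete divergence theorem: the terms with both ends in \<open>A\<close> cancel in pairs, and only the
  cut edge leads out of \<open>A\<close>.\<close>
lemma sum_over_cut:
  fixes g :: "'a \<Rightarrow> 'a \<Rightarrow> real"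
  assumes cut: "is_cut G A a b" and b: "b \<in> verts G" and fin: "finite (verts G)"
    and anti: "\<And>i k. g k i = - g i k"
    and off: "\<And>i k. {i, k} \<notin> edges G \<Longrightarrow> g i k = 0"
  shows "(\<Sum>i\<in>A. \<Sum>k\<in>verts G. g i k) = g a b"
proof -
  have AV: "A \<subseteq> verts G" and aA: "a \<in> A" and bA: "b \<notin> A" using is_cutD[OF cut] by auto
  have finA: "finite A" using AV fin finite_subset by blast
  have "(\<Sum>i\<in>A. \<Sum>k\<in>A. g i k) = (\<Sum>i\<in>A. \<Sum>k\<in>A. (g i k + g k i) / 2)"
    by (rule sum_swap_symmetric)
  moreover have "g i k + g k i = 0" for i k using anti[of i k] by simp
  ultimately have inner: "(\<Sum>i\<in>A. \<Sum>k\<in>A. g i k) = 0" by simp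
  have zero: "g i k = 0" if "i \<in> A" "k \<in> verts G - A" "i \<noteq> a \<or> k \<noteq> b" for i k
    using cut off that unfolding is_cut_def by blast
  have "(\<Sum>i\<in>A. \<Sum>k\<in>verts G - A. g i k) = (\<Sum>i\<in>{a}. \<Sum>k\<in>verts G - A. g i k)"
    using finA aA zero by (intro sum.mono_neutral_right) (auto intro!: sum.neutral)
  also have "\<dots> = (\<Sum>k\<in>verts G - A. g a k)" by simp
  also have "\<dots> = (\<Sum>k\<in>{b}. g a k)"
    using fin aA b bA zero by (intro sum.mono_neutral_right) auto
  finally have "(\<Sum>i\<in>A. \<Sum>k\<in>verts G - A. g i k) = g a b" by simp
  moreover have "(\<Sum>k\<in>verts G. g i k) = (\<Sum>k\<in>verts G - A. g i k) + (\<Sum>k\<in>A. g i k)" for i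
    using sum.subset_diff[OF AV fin] .
  ultimately show ?thesis using inner by (simp add: sum.distrib)
qed

locale tree_network =
  fixes G :: "'a wgraph"
  assumes tree: "weighted_tree G"
begin

sublocale connected_network G by (rule tree_imp_network[OF tree])

lemma cut_flow:
  assumes "is_cut G A a b" "{a, b} \<in> edges G"
  shows "(\<Sum>i\<in>A. lap G x i) = W a b * (x a - x b)"
  unfolding lap_def
proof (rule sum_over_cut[OF assms(1) _ finite_V])
  show "b \<in> V" using edge_endpoints(2)[OF simple assms(2)] .
  show "W k i * (x k - x i) = - (W i k * (x i - x k))" for i k
    by (simp add: edge_weight_commute[of G k i] algebra_simps)
  show "W i k * (x i - x k) = 0" if "{i, k} \<notin> edges G" for i k
    using that by (simp add: edge_weight_def)
qed

text \<open>Green's identity on one side of the edge: the integrand \<open>y * lap G x - x * lap G y\<close> is zero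
  there, and the only boundary term is the one of the edge.\<close>
lemma eigenfunctions_proportional_on_edge:
  assumes x: "\<And>i. i \<in> V \<Longrightarrow> lap G x i = c * x i"
    and y: "\<And>i. i \<in> V \<Longrightarrow> lap G y i = c * y i"
    and ab: "{a, b} \<in> edges G"
  shows "x a * y b = x b * y a"
proof -
  obtain A where A: "is_cut G A a b" using tree_edge_cut[OF tree ab] by blast
  have AV: "A \<subseteq> V" using is_cutD(1)[OF A] .
  define g where "g = (\<lambda>i k. W i k * (x i * y k - y i * x k))"
  have "0 = (\<Sum>i\<in>A. y i * lap G x i - x i * lap G y i)"
    using x y AV by (intro sum.neutral[symmetric]) auto
  also have "\<dots> = (\<Sum>i\<in>A. \<Sum>k\<in>V. g i k)"
    unfolding lap_def sum_distrib_left sum_subtractf[symmetric] g_def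
    by (intro sum.cong refl) (simp add: algebra_simps)
  also have "\<dots> = g a b"
  proof (rule sum_over_cut[OF A _ finite_V])
    show "b \<in> V" using edge_endpoints(2)[OF simple ab] .
    show "g k i = - g i k" for i k
      by (simp add: g_def edge_weight_commute[of G k i] algebra_simps)
    show "g i k = 0" if "{i, k} \<notin> edges G" for i k
      using that by (simp add: g_def edge_weight_def)
  qed
  finally have "W a b * (x a * y b - y a * x b) = 0" by (simp add: g_def)
  moreover have "0 < W a b" using W_pos_iff ab by blast
  ultimately show ?thesis by simp
qed

text \<open>The ratio \<open>y / x\<close> is the same at both ends of every edge, hence constant.\<close>
lemma nowhere_zero_eigenfunction_simple:
  assumes x: "\<And>i. i \<in> V \<Longrightarrow> lap G x i = c * x i" and nz: "\<And>i. i \<in> V \<Longrightarrow> x i \<noteq> 0"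
    and y: "\<And>i. i \<in> V \<Longrightarrow> lap G y i = c * y i"
  shows "\<exists>s. \<forall>i\<in>V. y i = s * x i"
proof -
  obtain u where u: "u \<in> V" using V_nonempty by blast
  define s where "s = y u / x u"
  have "y v = s * x v" if "v \<in> V" for v
  proof (rule connected_propagate[of u "\<lambda>v. y v = s * x v", OF u _ _ that])
    show "y u = s * x u" using nz[OF u] by (simp add: s_def)
    fix i k assume ik: "{i, k} \<in> edges G" "y i = s * x i"
    have "x i * y k = x k * y i" by (rule eigenfunctions_proportional_on_edge[OF x y ik(1)])
    moreover have "x i \<noteq> 0" using nz edge_endpoints(1)[OF simple ik(1)] .
    ultimately show "y k = s * x k" using ik(2) by (simp add: field_simps)
  qed
  then show ?thesis by blast
qed

text \<open>Suppose that there were two such edges, with sides \<open>A\<close> and \<open>B\<close>. The sum of \<open>x\<close> over either side is not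
  zero, since it is proportional to the difference of \<open>x\<close> across the edge. Hence some
  combination \<open>d\<close> of the two indicator functions is nonconstant while \<open>d * x\<close> has sum zero. It
  changes only across the two edges, where \<open>x\<close> changes sign, so the Rayleigh quotient of
  \<open>d * x\<close> is below the minimum.\<close>
lemma sign_change_edge_unique:
  assumes card: "2 \<le> card V"
    and eig: "eigenfunction G (algebraic_connectivity G) x"
    and ab: "{a, b} \<in> edges G" "x a * x b < 0"
    and ef: "{e, f} \<in> edges G" "x e * x f < 0"
  shows "{a, b} = {e, f}"
proof (rule ccontr)
  assume ne: "{a, b} \<noteq> {e, f}"
  define c where "c = algebraic_connectivity G"
  have c: "0 < c" using algebraic_connectivity_spectral(1)[OF card] by (simp add: c_def)
  have x: "lap G x i = c * x i" if "i \<in> V" for i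
    using eig that by (simp add: eigenfunction_def c_def)
  have flow: "sum x A \<noteq> 0" if A: "is_cut G A i k" and ik: "{i, k} \<in> edges G" "x i * x k < 0" for A i k
  proof
    assume "sum x A = 0"
    moreover have "(\<Sum>i\<in>A. lap G x i) = c * sum x A"
      using x is_cutD(1)[OF A] unfolding sum_distrib_left by (intro sum.cong) auto
    ultimately have "W i k * (x i - x k) = 0" using cut_flow[OF A ik(1), of x] by simp
    then have "x i = x k" using W_pos_iff[of i k] ik(1) by auto
    then show False using ik(2) by (simp add: not_less)
  qed
  obtain A where A: "is_cut G A a b" using tree_edge_cut[OF tree ab(1)] by blast
  obtain B where B: "is_cut G B e f" using tree_edge_cut[OF tree ef(1)] by blast
  have AV: "A \<subseteq> V" and BV: "B \<subseteq> V" using is_cutD(1)[OF A] is_cutD(1)[OF B] .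
  have sA: "sum x A \<noteq> 0" and sB: "sum x B \<noteq> 0" using flow[OF A ab] flow[OF B ef] .
  define d where "d = (\<lambda>i. (if i \<in> A then sum x B else 0) - (if i \<in> B then sum x A else 0))"
  have restr: "(\<Sum>i\<in>V. (if i \<in> S then s else 0) * x i) = s * sum x S" if "S \<subseteq> V" for S s
  proof -
    have "(\<Sum>i\<in>V. (if i \<in> S then s else 0) * x i) = (\<Sum>i\<in>S. s * x i)"
      using that finite_V by (intro sum.mono_neutral_cong_right) auto
    then show ?thesis by (simp add: sum_distrib_left)
  qed
  have "(\<Sum>i\<in>V. d i * x i) = 0"
    unfolding d_def left_diff_distrib sum_subtractf restr[OF AV] restr[OF BV] by simp
  then have "c * (\<Sum>i\<in>V. (d i * x i)\<^sup>2) \<le> (\<Sum>i\<in>V. d i * x i * lap G (\<lambda>i. d i * x i) i)"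
    using algebraic_connectivity_spectral(3)[OF card] by (simp add: c_def)
  moreover define g where "g = (\<lambda>i k. W i k * (x i * x k) * (d i - d k)\<^sup>2)"
  ultimately have ge: "0 \<le> (\<Sum>i\<in>V. \<Sum>k\<in>V. g i k)"
    using rayleigh_of_product[OF x, of d] by simp
  have le: "g i k \<le> 0" for i k
  proof (cases "{i, k} \<in> edges G \<and> d i \<noteq> d k")
    case True
    have "{i, k} = {a, b} \<or> {i, k} = {e, f}"
    proof (rule ccontr)
      assume "\<not> ?thesis"
      then have "i \<in> A \<longleftrightarrow> k \<in> A" "i \<in> B \<longleftrightarrow> k \<in> B"
        using cut_other_edge[OF A, of i k] cut_other_edge[OF B, of i k] True by simp_all
      then show False using True by (simp add: d_def)
    qed
    then have "x i * x k < 0"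
      using ab(2) ef(2) by (auto simp: doubleton_eq_iff mult.commute)
    then show ?thesis using W_nonneg[of i k]
      by (simp add: g_def mult_nonneg_nonpos mult_nonpos_nonneg)
  next
    case False
    then show ?thesis by (auto simp: g_def edge_weight_def)
  qed
  have "a \<in> B \<longleftrightarrow> b \<in> B" using cut_other_edge[OF B ab(1) ne] .
  then have "d a - d b = sum x B" using is_cutD[OF A] by (simp add: d_def)
  then have "g a b < 0"
    using ab(2) sB W_pos_iff[of a b] ab(1) by (simp add: g_def mult_pos_neg mult_neg_pos)
  have abV: "a \<in> V" "b \<in> V" using edge_endpoints[OF simple ab(1)] by auto
  have "(\<Sum>k\<in>V. g a k) < 0"
    using sum_strict_mono_ex1[OF finite_V, of "g a" "\<lambda>_. 0"] le \<open>g a b < 0\<close> abV by auto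
  moreover have "(\<Sum>k\<in>V. g i k) \<le> 0" for i using le by (simp add: sum_nonpos)
  ultimately have "(\<Sum>i\<in>V. \<Sum>k\<in>V. g i k) < 0"
    using sum_strict_mono_ex1[OF finite_V, of "\<lambda>i. \<Sum>k\<in>V. g i k" "\<lambda>_. 0"] abV by auto
  then show False using ge by simp
qed

end

section \<open>Series reduction\<close>

lemma eigenfunction_cong:
  "(\<And>i. i \<in> verts K \<Longrightarrow> y i = z i) \<Longrightarrow> eigenfunction K c y \<longleftrightarrow> eigenfunction K c z"
  unfolding eigenfunction_def using lap_cong[of K y z] by auto

text \<open>The vertex \<open>r\<close> is eliminated like the point between two resistors in series.\<close>
locale series_reduction = tree_network G for G :: "'a wgraph" +
  fixes p r q :: 'a
  assumes nbrs: "neighbors G r = {p, q}" and pq: "p \<noteq> q"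
begin

abbreviation "H \<equiv> contract G p r q"
abbreviation "wp \<equiv> wt G {p, r}"
abbreviation "wq \<equiv> wt G {q, r}"

sublocale H: tree_network H
  by unfold_locales (rule contract_tree[OF tree nbrs pq])

lemma edges_at_r: "{p, r} \<in> edges G" "{q, r} \<in> edges G"
  using nbrs by (auto simp: neighbors_def)

lemma verts_pqr: "p \<in> V" "q \<in> V" "r \<in> V" "p \<noteq> r" "q \<noteq> r"
  using edge_endpoints[OF simple edges_at_r(1)] edge_endpoints[OF simple edges_at_r(2)] by auto

lemma edge_at_r_iff: "{i, r} \<in> edges G \<longleftrightarrow> i = p \<or> i = q"
  using nbrs by (auto simp: neighbors_def)

lemma wp_pos: "0 < wp" and wq_pos: "0 < wq"
  using wt_pos edges_at_r by auto

lemma verts_H: "verts H = V - {r}"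
  by (rule contract_simps(1))

lemma card_V: "2 \<le> card V" and card_H: "2 \<le> card (verts H)"
proof -
  have "{p, q} \<subseteq> verts H" "{p, q} \<subseteq> V" using verts_pqr by (auto simp: verts_H)
  then have "card {p, q} \<le> card (verts H)" "card {p, q} \<le> card V"
    using card_mono[OF H.finite_V] card_mono[OF finite_V] by blast+
  then show "2 \<le> card V" "2 \<le> card (verts H)" using pq by auto
qed

lemma W_r: "W i r = (if i = p then wp else if i = q then wq else 0)"
  using edge_at_r_iff[of i] by (auto simp: edge_weight_def)

lemma sum_V: "(\<Sum>i\<in>V. f i) = f r + (\<Sum>i\<in>verts H. f i)" for f :: "'a \<Rightarrow> real"
  unfolding verts_H using finite_V verts_pqr(3) by (rule sum.remove)

lemma sum_two: "(\<Sum>k\<in>verts H. (if k = p then s else if k = q then t else 0)) = s + t" for s t :: real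
proof -
  have "(\<Sum>k\<in>verts H. (if k = p then s else if k = q then t else 0))
      = (\<Sum>k\<in>{p, q}. (if k = p then s else if k = q then t else 0))"
    using verts_pqr H.finite_V by (intro sum.mono_neutral_right) (auto simp: verts_H)
  then show ?thesis using pq by simp
qed

lemma lap_at_r: "lap G x r = wp * (x r - x p) + wq * (x r - x q)"
proof -
  have "lap G x r = (\<Sum>k\<in>verts H. W r k * (x r - x k))"
    unfolding lap_def sum_V by simp
  also have "\<dots> = (\<Sum>k\<in>verts H.
      (if k = p then wp * (x r - x p) else if k = q then wq * (x r - x q) else 0))"
    by (intro sum.cong refl) (simp add: edge_weight_commute[of G r] W_r)
  finally show ?thesis by (simp add: sum_two)
qed

lemma edge_weight_contract:
  assumes "i \<in> verts H" "k \<in> verts H"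
  shows "edge_weight H i k = W i k + (if {i, k} = {p, q} then wp * wq / (wp + wq) else 0)"
proof -
  have "{i, k} \<noteq> {p, r}" "{i, k} \<noteq> {q, r}"
    using assms by (auto simp: verts_H doubleton_eq_iff)
  then show ?thesis
    using tree_no_triangle[OF tree nbrs pq] by (auto simp: edge_weight_def contract_simps(2,3))
qed

text \<open>The Laplacian of the contraction is the Schur complement of the Laplacian at \<open>r\<close>: if \<open>x r\<close> is
  the weighted mean of its two neighbours, then the flows from \<open>p\<close> and from \<open>q\<close> into \<open>r\<close> are
  those through the edge of the series weight.\<close>
lemma lap_contract:
  assumes r: "lap G x r = 0" and i: "i \<in> verts H"
  shows "lap G x i = lap H x i"
proof -
  define w where "w = wp * wq / (wp + wq)"
  have xr: "x r = (wp * x p + wq * x q) / (wp + wq)"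
    using r wp_pos wq_pos unfolding lap_at_r by (simp add: field_simps)
  have wpw: "wp * (x p - x r) = w * (x p - x q)" and wqw: "wq * (x q - x r) = w * (x q - x p)"
    using wp_pos wq_pos unfolding xr w_def by (simp_all add: divide_simps) (simp_all add: algebra_simps)
  have new: "(\<Sum>k\<in>verts H. (if {i, k} = {p, q} then w else 0) * (x i - x k)) = W i r * (x i - x r)"
  proof (cases "i = p \<or> i = q")
    case False
    then have "W i r = 0" and "{i, k} \<noteq> {p, q}" for k by (auto simp: W_r)
    then show ?thesis by simp
  next
    case True
    then show ?thesis
    proof
      assume i: "i = p"
      have "(\<Sum>k\<in>verts H. (if {i, k} = {p, q} then w else 0) * (x i - x k))
        = (\<Sum>k\<in>verts H. (if k = p then 0 else if k = q then w * (x p - x q) else 0))"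
        using pq i by (intro sum.cong refl) (auto simp: doubleton_eq_iff)
      then show ?thesis using i by (simp add: sum_two W_r wpw)
    next
      assume i: "i = q"
      have "(\<Sum>k\<in>verts H. (if {i, k} = {p, q} then w else 0) * (x i - x k))
        = (\<Sum>k\<in>verts H. (if k = p then w * (x q - x p) else if k = q then 0 else 0))"
        using pq i by (intro sum.cong refl) (auto simp: doubleton_eq_iff)
      then show ?thesis using i pq by (simp add: sum_two W_r wqw)
    qed
  qed
  have "lap H x i = (\<Sum>k\<in>verts H. W i k * (x i - x k)
      + (if {i, k} = {p, q} then w else 0) * (x i - x k))"
    unfolding lap_def
    by (intro sum.cong refl) (simp add: edge_weight_contract[OF i] w_def distrib_right)
  also have "\<dots> = (\<Sum>k\<in>verts H. W i k * (x i - x k)) + W i r * (x i - x r)"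
    by (simp add: sum.distrib new)
  also have "\<dots> = lap G x i" unfolding lap_def sum_V by simp
  finally show ?thesis ..
qed

text \<open>Extend an eigenfunction \<open>y\<close> of the contraction harmonically to \<open>r\<close> and subtract the mean
  value. The Dirichlet form does not change. The square norm does not decrease, as \<open>y\<close> has sum
  zero: it grows by \<open>t^2 - t^2 / n\<close>, where \<open>t\<close> is the value at \<open>r\<close> and \<open>n\<close> the number of
  vertices.\<close>
lemma connectivity_le_contract: "algebraic_connectivity G \<le> algebraic_connectivity H"
proof -
  define m where "m = algebraic_connectivity H"
  obtain y where y: "eigenfunction H m y"
    using H.algebraic_connectivity_spectral(2)[OF card_H] by (auto simp: m_def)
  have m: "0 < m" using H.algebraic_connectivity_spectral(1)[OF card_H] by (simp add: m_def)
  have sumy: "(\<Sum>i\<in>verts H. y i) = 0" using eigenfunction_sum_zero[OF y] m by simp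
  define t where "t = (wp * y p + wq * y q) / (wp + wq)"
  define z where "z = y(r := t)"
  have zH: "z i = y i" if "i \<in> verts H" for i using that by (simp add: z_def verts_H)
  have "lap G z r = 0"
    using wp_pos wq_pos verts_pqr unfolding lap_at_r
    by (simp add: z_def t_def divide_simps) (simp add: algebra_simps)
  then have lapz: "lap G z i = m * y i" if "i \<in> verts H" for i
    using lap_contract[OF _ that] lap_cong[of H z y i] zH that y by (simp add: eigenfunction_def)
  define s where "s = t / card V"
  define u where "u = (\<lambda>i. z i - s)"
  have n: "0 < card V" using card_V by simp
  have sumz: "(\<Sum>i\<in>V. z i) = t" using sumy zH by (simp add: sum_V) (simp add: z_def)
  then have "(\<Sum>i\<in>V. u i) = 0" using n by (simp add: u_def sum_subtractf s_def)
  then have "algebraic_connectivity G * (\<Sum>i\<in>V. (u i)\<^sup>2) \<le> (\<Sum>i\<in>V. u i * lap G u i)"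
    by (rule algebraic_connectivity_spectral(3)[OF card_V])
  also have "\<dots> = (\<Sum>i\<in>V. z i * lap G z i) - s * (\<Sum>i\<in>V. lap G z i)"
    by (simp add: u_def lap_shift left_diff_distrib sum_subtractf sum_distrib_left)
  also have "\<dots> = (\<Sum>i\<in>verts H. z i * lap G z i)"
    using \<open>lap G z r = 0\<close> by (simp add: sum_lap) (simp add: sum_V)
  also have "\<dots> = m * (\<Sum>i\<in>verts H. (y i)\<^sup>2)"
    unfolding sum_distrib_left using zH lapz
    by (intro sum.cong refl) (simp add: power2_eq_square)
  finally have le: "algebraic_connectivity G * (\<Sum>i\<in>V. (u i)\<^sup>2) \<le> m * (\<Sum>i\<in>verts H. (y i)\<^sup>2)" .
  have "(\<Sum>i\<in>V. (u i)\<^sup>2) = (\<Sum>i\<in>V. (z i)\<^sup>2) - 2 * s * (\<Sum>i\<in>V. z i) + card V * s\<^sup>2"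
    by (simp add: u_def power2_diff sum.distrib sum_subtractf sum_distrib_left mult_ac)
  also have "\<dots> = (\<Sum>i\<in>V. (z i)\<^sup>2) - t\<^sup>2 / card V"
    using n unfolding sumz s_def by (simp add: field_simps power2_eq_square)
  also have "(\<Sum>i\<in>V. (z i)\<^sup>2) = t\<^sup>2 + (\<Sum>i\<in>verts H. (y i)\<^sup>2)"
    unfolding sum_V using zH by (simp add: z_def)
  finally have "(\<Sum>i\<in>V. (u i)\<^sup>2) = (\<Sum>i\<in>verts H. (y i)\<^sup>2) + (t\<^sup>2 - t\<^sup>2 / card V)" by simp
  moreover have "t\<^sup>2 / card V \<le> t\<^sup>2"
    using n mult_left_mono[of 1 "real (card V)" "t\<^sup>2"] by (simp add: divide_le_eq)
  ultimately have "(\<Sum>i\<in>verts H. (y i)\<^sup>2) \<le> (\<Sum>i\<in>V. (u i)\<^sup>2)" by simp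
  then have "algebraic_connectivity G * (\<Sum>i\<in>verts H. (y i)\<^sup>2)
      \<le> algebraic_connectivity G * (\<Sum>i\<in>V. (u i)\<^sup>2)"
    using algebraic_connectivity_spectral(1)[OF card_V] by (intro mult_left_mono) auto
  then have "algebraic_connectivity G * (\<Sum>i\<in>verts H. (y i)\<^sup>2) \<le> m * (\<Sum>i\<in>verts H. (y i)\<^sup>2)"
    using le by linarith
  moreover have "0 < (\<Sum>i\<in>verts H. (y i)\<^sup>2)"
    using y by (intro H.sum_squares_pos) (simp add: eigenfunction_def)
  ultimately show ?thesis by (simp add: m_def)
qed

lemma eigenfunction_contract_iff:
  assumes "x r = 0" "wp * x p + wq * x q = 0"
  shows "eigenfunction G c x \<longleftrightarrow> eigenfunction H c x"
proof -
  have r: "lap G x r = 0" using assms by (simp add: lap_at_r algebra_simps)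
  have "(\<exists>i\<in>V. x i \<noteq> 0) \<longleftrightarrow> (\<exists>i\<in>verts H. x i \<noteq> 0)"
    using assms(1) by (auto simp: verts_H)
  moreover have "(\<forall>i\<in>V. lap G x i = c * x i) \<longleftrightarrow> (\<forall>i\<in>verts H. lap G x i = c * x i)"
    using r assms(1) by (auto simp: verts_H)
  ultimately show ?thesis
    unfolding eigenfunction_def using lap_contract[OF r] by simp
qed

end

section \<open>Characteristic vertices\<close>

lemma char_set_of_scale:
  assumes "simple_graph G" "\<And>i. i \<in> verts G \<Longrightarrow> y i = s * x i" "s \<noteq> (0::real)"
  shows "char_set_of G y = char_set_of G x"
proof -
  have edge: "(y j = 0 \<longleftrightarrow> x j = 0) \<and> (y i * y j < 0 \<longleftrightarrow> x i * x j < 0)" if "{i, j} \<in> edges G" for i j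
  proof -
    have "y i = s * x i" "y j = s * x j" using assms(2) edge_endpoints[OF assms(1) that] by auto
    then have "y i * y j = s\<^sup>2 * (x i * x j)" by (simp add: power2_eq_square)
    moreover have "0 < s\<^sup>2" using assms(3) by simp
    then have "s\<^sup>2 * (x i * x j) < 0 \<longleftrightarrow> x i * x j < 0"
      using mult_less_cancel_left_pos[of "s\<^sup>2" "x i * x j" 0] by simp
    ultimately have "y i * y j < 0 \<longleftrightarrow> x i * x j < 0" by (simp only:)
    then show ?thesis using \<open>y j = s * x j\<close> assms(3) by simp
  qed
  moreover have "y i = 0 \<longleftrightarrow> x i = 0" if "i \<in> verts G" for i using assms(2)[OF that] assms(3) by simp
  ultimately show ?thesis unfolding char_set_of_def by (auto cong: conj_cong)
qed

text \<open>The situation of a tree of Type I whose characteristic vertex \<open>r\<close> has degree 2: both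
  branches at \<open>r\<close> are free of zeros.\<close>
locale char_vertex = series_reduction G p r q for G :: "'a wgraph" and p r q +
  fixes x :: "'a \<Rightarrow> real"
  assumes fiedler: "fiedler_vector G x"
    and x_r: "x r = 0"
    and x_nonzero: "\<And>i. i \<in> V \<Longrightarrow> i \<noteq> r \<Longrightarrow> x i \<noteq> 0"
begin

lemma eig: "eigenfunction G (algebraic_connectivity G) x"
  using fiedler by (simp add: fiedler_vector_iff)

lemma balance: "wp * x p + wq * x q = 0"
proof -
  have "lap G x r = algebraic_connectivity G * x r"
    using eig verts_pqr(3) by (simp add: eigenfunction_def)
  then show ?thesis by (simp add: lap_at_r x_r algebra_simps)
qed

lemma x_p_x_q_opposite: "x p * x q < 0"
proof -
  have "wq * (x p * x q) = x p * (wp * x p + wq * x q) - wp * (x p)\<^sup>2"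
    by (simp add: algebra_simps power2_eq_square)
  then have "wq * (x p * x q) = - (wp * (x p)\<^sup>2)" by (simp add: balance)
  moreover have "0 < wp * (x p)\<^sup>2" using wp_pos x_nonzero[of p] verts_pqr by simp
  ultimately have "wq * (x p * x q) < 0" by simp
  then show ?thesis using wq_pos by (simp add: mult_less_0_iff[of wq])
qed

lemma char_set: "char_set_of G x = {r}"
proof -
  have "{r, p} \<in> edges G" using edges_at_r by (simp add: insert_commute)
  then have "\<exists>j. {r, j} \<in> edges G \<and> x j \<noteq> 0" using x_nonzero[of p] verts_pqr by auto
  then show ?thesis using x_r x_nonzero verts_pqr(3) by (auto simp: char_set_of_def)
qed

lemma characteristic_set: "characteristic_set G {r}"
  unfolding characteristic_set_def using fiedler char_set by blast

lemma in_T1_2: "G \<in> T1_2"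
proof -
  have "type_I G" unfolding type_I_def using fiedler x_r verts_pqr(3) by blast
  moreover have "degree_of G r = 2" using nbrs pq by (simp add: degree_of_def)
  ultimately show ?thesis unfolding T1_2_def using tree characteristic_set by blast
qed

lemma char_contraction: "char_contraction G H"
  unfolding char_contraction_def using in_T1_2 characteristic_set nbrs pq by blast

text \<open>Proportionality on the edge \<open>{p, r}\<close> forces \<open>y r = 0\<close>. The ratio \<open>y / x\<close> is then constant on each
  of the two branches at \<open>r\<close>, and the eigenvalue equation at \<open>r\<close> makes the two constants equal.\<close>
lemma eigenfunction_multiple:
  assumes y: "eigenfunction G (algebraic_connectivity G) y"
  obtains s where "s \<noteq> 0" "\<And>i. i \<in> V \<Longrightarrow> y i = s * x i"
proof -
  have ex: "lap G x i = algebraic_connectivity G * x i"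
    and ey: "lap G y i = algebraic_connectivity G * y i" if "i \<in> V" for i
    using eig y that by (simp_all add: eigenfunction_def)
  have edge: "x a * y b = x b * y a" if "{a, b} \<in> edges G" for a b
    by (rule eigenfunctions_proportional_on_edge[where x = x and y = y, OF ex ey that])
  have xp: "x p \<noteq> 0" "x q \<noteq> 0" using x_nonzero verts_pqr by auto
  have yr: "y r = 0" using edge[OF edges_at_r(1)] x_r xp by simp
  have "lap G y r = algebraic_connectivity G * y r"
    using y verts_pqr(3) by (simp add: eigenfunction_def)
  then have ybal: "wp * y p + wq * y q = 0" by (simp add: lap_at_r yr algebra_simps)
  define s where "s = y p / x p"
  have sp: "y p = s * x p" using xp by (simp add: s_def)
  have "wq * y q = wq * (s * x q)"
  proof -
    have "wq * (s * x q) = s * (wp * x p + wq * x q) - wp * (s * x p)"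
      by (simp add: algebra_simps)
    then have "wq * (s * x q) = - (wp * (s * x p))" by (simp add: balance)
    then show ?thesis using ybal sp by simp
  qed
  then have sq: "y q = s * x q" using wq_pos by simp
  have all: "y i = s * x i" if "i \<in> V" for i
  proof (rule connected_propagate[of r "\<lambda>i. y i = s * x i", OF verts_pqr(3) _ _ that])
    show "y r = s * x r" using yr x_r by simp
    fix i k assume ik: "{i, k} \<in> edges G" "y i = s * x i"
    show "y k = s * x k"
    proof (cases "i = r")
      case True
      then show ?thesis using edge_at_r_iff[of k] ik(1) sp sq by (auto simp: insert_commute)
    next
      case False
      then have "x i \<noteq> 0" using x_nonzero edge_endpoints(1)[OF simple ik(1)] by blast
      then show ?thesis using edge[OF ik(1)] ik(2) by (simp add: field_simps)
    qed
  qed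
  have "s \<noteq> 0" using all y by (auto simp: eigenfunction_def)
  then show thesis using all by (rule that)
qed

text \<open>The eigenfunction \<open>x\<close> shows that the algebraic connectivity of \<open>G\<close> is a positive eigenvalue of
  the contraction, which bounds the one of \<open>H\<close> from above.\<close>
lemma connectivity_contract: "algebraic_connectivity H = algebraic_connectivity G"
proof -
  have "eigenfunction H (algebraic_connectivity G) x"
    using eig eigenfunction_contract_iff[OF x_r balance] by blast
  then have "algebraic_connectivity H \<le> algebraic_connectivity G"
    using H.algebraic_connectivity_le_eigenvalue[OF card_H]
      algebraic_connectivity_spectral(1)[OF card_V] by blast
  then show ?thesis using connectivity_le_contract by simp
qed

lemma fiedler_multiple:
  assumes "fiedler_vector G y"
  obtains s where "s \<noteq> 0" "\<And>i. i \<in> V \<Longrightarrow> y i = s * x i"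
  using eigenfunction_multiple assms fiedler_vector_iff by blast

lemma fiedler_restrict:
  assumes "fiedler_vector G y"
  shows "fiedler_vector H (restrict y (V - {r}))"
proof -
  obtain s where s: "\<And>i. i \<in> V \<Longrightarrow> y i = s * x i" using fiedler_multiple[OF assms] by blast
  have "y r = 0" using s verts_pqr(3) x_r by simp
  moreover have "wp * y p + wq * y q = s * (wp * x p + wq * x q)"
    using s verts_pqr by (simp add: algebra_simps)
  then have "wp * y p + wq * y q = 0" by (simp add: balance)
  ultimately have "eigenfunction H (algebraic_connectivity H) y"
    using assms eigenfunction_contract_iff connectivity_contract by (simp add: fiedler_vector_iff)
  then have "eigenfunction H (algebraic_connectivity H) (restrict y (V - {r}))"
    using eigenfunction_cong[of H "restrict y (V - {r})" y] by (simp add: verts_H)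
  then show ?thesis using card_H by (simp add: H.fiedler_vector_iff verts_H)
qed

lemma fiedler_extend:
  assumes "fiedler_vector H y"
  shows "fiedler_vector G (y(r := 0))"
proof -
  have eigH: "eigenfunction H (algebraic_connectivity H) x"
    using eig eigenfunction_contract_iff[OF x_r balance] connectivity_contract by simp
  have y: "eigenfunction H (algebraic_connectivity H) y" "y \<in> extensional (verts H)"
    using assms by (simp_all add: H.fiedler_vector_iff)
  obtain s where s: "\<forall>i\<in>verts H. y i = s * x i"
    using H.nowhere_zero_eigenfunction_simple[of x "algebraic_connectivity H" y] eigH y x_nonzero
    by (auto simp: eigenfunction_def verts_H)
  have "wp * y p + wq * y q = s * (wp * x p + wq * x q)"
    using s verts_pqr by (simp add: algebra_simps verts_H)
  then have bal: "wp * (y(r := 0)) p + wq * (y(r := 0)) q = 0" using verts_pqr by (simp add: balance)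
  have "eigenfunction H (algebraic_connectivity H) (y(r := 0))"
    using eigenfunction_cong[of H "y(r := 0)" y] y by (simp add: verts_H)
  then have "eigenfunction G (algebraic_connectivity G) (y(r := 0))"
    using eigenfunction_contract_iff[OF fun_upd_same bal] unfolding connectivity_contract by blast
  moreover have "y(r := 0) \<in> extensional V"
    using y(2) verts_pqr(3) by (auto simp: extensional_def verts_H)
  ultimately show ?thesis using card_V by (simp add: fiedler_vector_iff)
qed

lemma contract_T2: "H \<in> T2"
  using H.tree fiedler_restrict[OF fiedler] x_nonzero
  by (auto simp: T2_def type_II_def verts_H intro!: exI[of _ "restrict x (V - {r})"])

end

text \<open>The function \<open>x\<close> does not vanish at both neighbours of \<open>r\<close>, and the eigenvalue equation at \<open>r\<close>
  excludes that it vanishes at just one of them. Away from \<open>r\<close> a zero next to a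
  nonzero value would be another element of the characteristic set, so nonzero values propagate
  along both branches.\<close>
lemma char_vertexI:
  assumes G: "weighted_tree G" and x: "fiedler_vector G x" and C: "char_set_of G x = {r}"
    and N: "neighbors G r = {p, q}" and pq: "p \<noteq> q"
  shows "char_vertex G p r q x"
proof -
  interpret series_reduction G p r q using G N pq by unfold_locales
  \<comment> \<open>Without zeros the characteristic set would contain both ends of an edge, so it would
    not be a singleton.\<close>
  have zero: "\<exists>i\<in>V. x i = 0"
  proof (rule ccontr)
    assume "\<not> ?thesis"
    then have C': "{i\<in>V. \<exists>j. {i, j} \<in> edges G \<and> x i * x j < 0} = {r}"
      using C by (simp add: char_set_of_def)
    then obtain j where j: "{r, j} \<in> edges G" "x r * x j < 0" by blast
    then have "j \<in> {i\<in>V. \<exists>j. {i, j} \<in> edges G \<and> x i * x j < 0}"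
      using edge_endpoints(2)[OF simple j(1)] by (auto simp: insert_commute mult.commute)
    then have "j = r" using C' by simp
    then show False using edge_endpoints(3)[OF simple j(1)] by simp
  qed
  then have C': "{i\<in>V. x i = 0 \<and> (\<exists>j. {i, j} \<in> edges G \<and> x j \<noteq> 0)} = {r}"
    using C by (simp add: char_set_of_def)
  then have xr: "x r = 0" and "\<exists>j. {r, j} \<in> edges G \<and> x j \<noteq> 0" by blast+
  then have "x p \<noteq> 0 \<or> x q \<noteq> 0" using edge_at_r_iff by (auto simp: insert_commute)
  moreover have "lap G x r = 0"
    using x verts_pqr(3) xr by (simp add: fiedler_vector_iff eigenfunction_def)
  then have "wp * x p + wq * x q = 0" by (simp add: lap_at_r xr algebra_simps)
  ultimately have xpq: "x p \<noteq> 0" "x q \<noteq> 0" using wp_pos wq_pos by auto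
  have "v = r \<or> x v \<noteq> 0" if "v \<in> V" for v
  proof (rule connected_propagate[of r "\<lambda>v. v = r \<or> x v \<noteq> 0", OF verts_pqr(3) _ _ that])
    fix i k assume ik: "{i, k} \<in> edges G" "i = r \<or> x i \<noteq> 0"
    show "k = r \<or> x k \<noteq> 0"
    proof (cases "i = r")
      case True
      then show ?thesis using ik(1) edge_at_r_iff[of k] xpq by (auto simp: insert_commute)
    next
      case False
      have "{k, i} \<in> edges G" "k \<in> V"
        using ik(1) edge_endpoints(2)[OF simple ik(1)] by (simp_all add: insert_commute)
      then have "x k = 0 \<Longrightarrow> k \<in> {r}" unfolding C'[symmetric] using False ik(2) by blast
      then show ?thesis by blast
    qed
  qed simp
  then show ?thesis using x xr by unfold_locales auto
qed

lemma char_contractionE: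
  assumes "char_contraction G H"
  obtains p r q x where "char_vertex G p r q x" "H = contract G p r q"
  using assms char_vertexI
  unfolding char_contraction_def characteristic_set_def T1_2_def by (smt (verit) mem_Collect_eq)

lemma T1_2E:
  assumes "G \<in> T1_2"
  obtains p r q x where "char_vertex G p r q x"
proof -
  obtain r x where rx: "fiedler_vector G x" "char_set_of G x = {r}" "card (neighbors G r) = 2"
    and G: "weighted_tree G"
    using assms unfolding T1_2_def characteristic_set_def degree_of_def by auto
  then obtain p q where "neighbors G r = {p, q}" "p \<noteq> q" by (auto simp: card_2_iff)
  then show thesis using char_vertexI[OF G rx(1,2)] that by blast
qed

lemma char_vertex_unique:
  assumes "char_vertex G p r q x" "char_vertex G p' r' q' x'"
  shows "r' = r" "contract G p' r' q' = contract G p r q"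
proof -
  interpret A: char_vertex G p r q x by fact
  interpret B: char_vertex G p' r' q' x' by fact
  obtain s where "s \<noteq> 0" "\<And>i. i \<in> verts G \<Longrightarrow> x' i = s * x i"
    using A.fiedler_multiple[OF B.fiedler] by blast
  then have "char_set_of G x' = char_set_of G x" using char_set_of_scale[OF A.simple] by blast
  then show r: "r' = r" using A.char_set B.char_set by simp
  then have "{p, q} = {p', q'}" using A.nbrs B.nbrs by simp
  then show "contract G p' r' q' = contract G p r q"
    using r contract_commute by (auto simp: doubleton_eq_iff)
qed

section \<open>Trees with a characteristic edge\<close>

text \<open>The type is witnessed by one Fiedler vector without zeros; as the eigenvalue is simple, every
  other Fiedler vector is a nonzero multiple of it.\<close>
lemma type_II_fiedler_multiple:
  assumes G: "G \<in> T2" and x: "fiedler_vector G x" and y: "fiedler_vector G y"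
  shows "\<forall>i\<in>verts G. x i \<noteq> 0" "\<exists>s. s \<noteq> 0 \<and> (\<forall>i\<in>verts G. y i = s * x i)"
proof -
  interpret tree_network G using G by unfold_locales (simp add: T2_def)
  obtain z where z: "fiedler_vector G z" "\<forall>i\<in>V. z i \<noteq> 0"
    using G by (auto simp: T2_def type_II_def)
  have mult: "\<exists>s. s \<noteq> 0 \<and> (\<forall>i\<in>V. v i = s * u i)"
    if u: "fiedler_vector G u" "\<forall>i\<in>V. u i \<noteq> 0" and v: "fiedler_vector G v" for u v
  proof -
    obtain s where s: "\<forall>i\<in>V. v i = s * u i"
      using nowhere_zero_eigenfunction_simple[of u "algebraic_connectivity G" v] u v
      by (auto simp: fiedler_vector_iff eigenfunction_def)
    moreover have "s \<noteq> 0" using s v by (auto simp: fiedler_vector_iff eigenfunction_def)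
    ultimately show ?thesis by blast
  qed
  show nz: "\<forall>i\<in>V. x i \<noteq> 0" using mult[OF z x] z(2) by auto
  show "\<exists>s. s \<noteq> 0 \<and> (\<forall>i\<in>V. y i = s * x i)" by (rule mult[OF x nz y])
qed

abbreviation subdivide_along :: "'a wgraph \<Rightarrow> ('a \<Rightarrow> real) \<Rightarrow> 'a \<Rightarrow> 'a \<Rightarrow> 'a \<Rightarrow> 'a wgraph" where
  "subdivide_along G x p r q \<equiv>
     subdivide G p r q (wt G {p, q} * (1 - x q / x p)) (wt G {p, q} * (1 - x p / x q))"

text \<open>The situation of a tree of Type II: by uniqueness of the sign change, \<open>{p, q}\<close> is its
  characteristic set.\<close>
locale char_edge = tree_network G for G :: "'a wgraph" +
  fixes p q :: 'a and x :: "'a \<Rightarrow> real"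
  assumes in_T2: "G \<in> T2"
    and fiedler: "fiedler_vector G x"
    and edge: "{p, q} \<in> edges G"
    and sign_change: "x p * x q < 0"
begin

lemma x_nonzero: "i \<in> V \<Longrightarrow> x i \<noteq> 0"
  using type_II_fiedler_multiple(1)[OF in_T2 fiedler fiedler] by blast

lemma p_neq_q: "p \<noteq> q" and verts_pq: "p \<in> V" "q \<in> V"
  using edge_endpoints[OF simple edge] by auto

lemma card_V: "2 \<le> card V" and eig: "eigenfunction G (algebraic_connectivity G) x"
  using fiedler by (simp_all add: fiedler_vector_iff)

lemma sign_change_iff:
  assumes "{i, k} \<in> edges G" shows "x i * x k < 0 \<longleftrightarrow> {i, k} = {p, q}"
proof
  assume "x i * x k < 0"
  then show "{i, k} = {p, q}"
    using sign_change_edge_unique[OF card_V eig assms _ edge sign_change] by blast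
next
  assume "{i, k} = {p, q}"
  then show "x i * x k < 0" using sign_change by (auto simp: doubleton_eq_iff mult.commute)
qed

lemma char_set: "char_set_of G x = {p, q}"
proof -
  have "char_set_of G x = {i\<in>V. \<exists>j. {i, j} \<in> edges G \<and> x i * x j < 0}"
    using x_nonzero by (auto simp: char_set_of_def)
  also have "\<dots> = {i\<in>V. \<exists>j. {i, j} = {p, q}}"
    using sign_change_iff edge by (metis (no_types, lifting))
  also have "\<dots> = {p, q}" using verts_pq by (auto simp: doubleton_eq_iff)
  finally show ?thesis .
qed

text \<open>The new weights are made for two equations: \<open>wp * x p + wq * x q = 0\<close>, so that \<open>x\<close>
  extended by 0 remains an eigenfunction, and \<open>wp * wq / (wp + wq) = w\<close>, so that
  contraction undoes the subdivision. The only sign change of \<open>x\<close> is now interrupted by a zero,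
  which keeps the algebraic connectivity from dropping.\<close>
lemma subdivide_along_char_vertex:
  assumes r: "r \<notin> V"
  shows "char_vertex (subdivide_along G x p r q) p r q (x(r := 0))" (is ?vertex)
    and "contract (subdivide_along G x p r q) p r q = G" (is ?contract)
proof -
  define a b w where "a = x p" and "b = x q" and "w = wt G {p, q}"
  define wp wq where "wp = w * (1 - b / a)" and "wq = w * (1 - a / b)"
  define K where "K = subdivide G p r q wp wq"
  have K: "subdivide_along G x p r q = K" by (simp add: K_def wp_def wq_def a_def b_def w_def)
  have ab: "a * b < 0" "a \<noteq> 0" "b \<noteq> 0" using sign_change by (auto simp: a_def b_def)
  have w: "0 < w" using wt_pos[OF edge] by (simp add: w_def)
  have "b / a < 0" "a / b < 0" using ab by (auto simp: divide_less_0_iff mult_less_0_iff)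
  then have pos: "0 < wp" "0 < wq" using w by (simp_all add: wp_def wq_def)
  have "a - b \<noteq> 0" using ab(1) by (auto simp: not_less)
  have wpa: "wp * a = w * (a - b)" and wqb: "wq * b = w * (b - a)"
    using ab by (simp_all add: wp_def wq_def algebra_simps)
  have "(wp * wq) * (a * b) = (w * (wp + wq)) * (a * b)"
  proof -
    have "(wp * wq) * (a * b) = (wp * a) * (wq * b)" by simp
    also have "\<dots> = w * ((wp * a) * b + (wq * b) * a)"
      unfolding wpa wqb by (simp add: algebra_simps)
    finally show ?thesis by (simp add: algebra_simps)
  qed
  then have "wp * wq = w * (wp + wq)" using ab by simp
  then have series: "wp * wq / (wp + wq) = wt G {p, q}" using pos by (simp add: w_def)
  have con: "contract K p r q = G"
    unfolding K_def by (rule contract_subdivide[OF tree edge r series])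
  have treeK: "weighted_tree K" unfolding K_def by (rule subdivide_tree[OF tree edge r pos])
  have nbrsK: "neighbors K r = {p, q}" unfolding K_def by (rule neighbors_subdivide[OF simple r])
  interpret S: series_reduction K p r q using treeK nbrsK p_neq_q by unfold_locales
  have wK: "wt K {p, r} = wp" "wt K {q, r} = wq"
    unfolding K_def by (rule wt_subdivide_new[OF p_neq_q])+
  have vK: "verts K = insert r V" by (simp add: K_def subdivide_simps)
  define y where "y = x(r := 0)"
  have yV: "y i = x i" if "i \<in> V" for i using that r by (auto simp: y_def)
  define c where "c = algebraic_connectivity G"
  have c: "0 < c" using algebraic_connectivity_spectral(1)[OF card_V] by (simp add: c_def)
  have bal: "wt K {p, r} * y p + wt K {q, r} * y q = 0"
    using wpa wqb verts_pq by (simp add: wK yV a_def[symmetric] b_def[symmetric] algebra_simps)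
  have "eigenfunction G c y"
    using eigenfunction_cong[of G y x c] yV eig by (simp add: c_def)
  moreover have "y r = 0" by (simp add: y_def)
  ultimately have eigK: "eigenfunction K c y"
    using S.eigenfunction_contract_iff[OF _ bal, of c] unfolding con by blast
  have "c \<le> algebraic_connectivity K"
  proof (rule S.eigenvalue_le_connectivity[OF S.card_V eigK c])
    show "r \<in> verts K" by (rule S.verts_pqr)
    show "y r = 0" by (simp add: y_def)
    show "y i \<noteq> 0" if "i \<in> verts K" "i \<noteq> r" for i
      using that x_nonzero yV by (auto simp: vK)
    show "0 \<le> y i * y k" if ik: "{i, k} \<in> edges K" for i k
    proof (cases "i = r \<or> k = r")
      case True
      then show ?thesis by (auto simp: y_def)
    next
      case False
      then have "{i, k} \<noteq> {p, r}" "{i, k} \<noteq> {q, r}" by (auto simp: doubleton_eq_iff)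
      then have "{i, k} \<in> edges G" "{i, k} \<noteq> {p, q}" using ik by (simp_all add: K_def subdivide_simps)
      then show ?thesis using sign_change_iff[of i k] False by (simp add: y_def)
    qed
  qed
  moreover have "algebraic_connectivity K \<le> c"
    using S.connectivity_le_contract by (simp add: con c_def)
  ultimately have "algebraic_connectivity K = c" by simp
  moreover have "y \<in> extensional (verts K)"
    using fiedler by (auto simp: fiedler_vector_iff extensional_def vK y_def)
  ultimately have "fiedler_vector K y" using eigK S.card_V by (simp add: S.fiedler_vector_iff)
  moreover have "y r = 0" by (simp add: y_def)
  moreover have "y i \<noteq> 0" if "i \<in> verts K" "i \<noteq> r" for i
    using that x_nonzero yV by (auto simp: vK)
  ultimately have "char_vertex K p r q y" by unfold_locales
  then show ?vertex by (simp only: K y_def)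
  show ?contract using con by (simp only: K)
qed

lemma char_subdivision:
  "r \<notin> V \<Longrightarrow> char_subdivision r G (subdivide_along G x p r q)"
  unfolding char_subdivision_def using in_T2 fiedler char_set p_neq_q by blast

end

text \<open>A Fiedler vector has sum zero, so it has to change sign across some edge of the connected tree.\<close>
lemma type_II_char_edge:
  assumes G: "G \<in> T2" obtains p q x where "char_edge G p q x"
proof -
  interpret tree_network G using G by unfold_locales (simp add: T2_def)
  obtain x where x: "fiedler_vector G x" "\<forall>i\<in>V. x i \<noteq> 0"
    using G by (auto simp: T2_def type_II_def)
  have card: "2 \<le> card V" using x(1) by (simp add: fiedler_vector_iff)
  have "(\<Sum>i\<in>V. x i) = 0"
    using x(1) eigenfunction_sum_zero algebraic_connectivity_spectral(1)[OF card]
    by (metis fiedler_vector_iff less_irrefl)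
  then obtain p q where "{p, q} \<in> edges G" "x p * x q < 0"
    using sign_change_edge_exists x(2) by blast
  then have "char_edge G p q x" using G x(1) by unfold_locales
  then show thesis by (rule that)
qed

lemma char_subdivisionE:
  assumes "char_subdivision r G K"
  obtains p q x where "char_edge G p q x" "r \<notin> verts G" "K = subdivide_along G x p r q"
proof -
  obtain x p q where G: "G \<in> T2" and r: "r \<notin> verts G" and x: "fiedler_vector G x"
    and pq: "p \<noteq> q" "char_set_of G x = {p, q}" and K: "K = subdivide_along G x p r q"
    using assms unfolding char_subdivision_def by blast
  interpret tree_network G using G by unfold_locales (simp add: T2_def)
  have "char_set_of G x = {i\<in>V. \<exists>j. {i, j} \<in> edges G \<and> x i * x j < 0}"
    using type_II_fiedler_multiple(1)[OF G x x] by (simp add: char_set_of_def)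
  then have C: "{i\<in>V. \<exists>j. {i, j} \<in> edges G \<and> x i * x j < 0} = {p, q}" using pq(2) by simp
  then obtain j where j: "{p, j} \<in> edges G" "x p * x j < 0" by blast
  then have "j \<in> {i\<in>V. \<exists>j. {i, j} \<in> edges G \<and> x i * x j < 0}"
    using edge_endpoints(2)[OF simple j(1)] by (auto simp: insert_commute mult.commute)
  then have "j = q" using C edge_endpoints(3)[OF simple j(1)] by auto
  then have "char_edge G p q x" using G x j by unfold_locales simp_all
  then show thesis using r K by (rule that)
qed

text \<open>The new weights depend on the Fiedler vector only through the ratio of its values at \<open>p\<close> and
  \<open>q\<close>, which is the same for all multiples.\<close>
lemma char_edge_unique:
  assumes "char_edge G p q x" "char_edge G p' q' x'"
  shows "subdivide_along G x' p' r q' = subdivide_along G x p r q"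
proof -
  interpret A: char_edge G p q x by fact
  interpret B: char_edge G p' q' x' by fact
  obtain s where s: "s \<noteq> 0" "\<forall>i\<in>verts G. x' i = s * x i"
    using type_II_fiedler_multiple(2)[OF A.in_T2 A.fiedler B.fiedler] by blast
  then have "char_set_of G x' = char_set_of G x"
    using char_set_of_scale[OF A.simple, of x' s x] by blast
  then have eq: "{p', q'} = {p, q}" using A.char_set B.char_set by simp
  have ratio: "x' q / x' p = x q / x p" "x' p / x' q = x p / x q"
    using s A.verts_pq by simp_all
  from eq have "p' = p \<and> q' = q \<or> p' = q \<and> q' = p" by (auto simp: doubleton_eq_iff)
  then show ?thesis
  proof
    assume "p' = p \<and> q' = q"
    then show ?thesis using ratio by simp
  next
    assume pq': "p' = q \<and> q' = p"
    have "subdivide_along G x' q r p = subdivide_along G x' p r q"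
      by (subst subdivide_commute[OF A.p_neq_q[symmetric]]) (simp add: insert_commute)
    then show ?thesis using pq' ratio by simp
  qed
qed

section \<open>The two constructions are inverse to each other\<close>

context char_vertex
begin

lemma char_edge_contract: "char_edge H p q (restrict x (V - {r}))"
proof -
  have "{p, q} \<in> edges H" by (simp add: contract_simps)
  then show ?thesis
    using contract_T2 fiedler_restrict[OF fiedler] x_p_x_q_opposite verts_pqr
    by unfold_locales auto
qed

text \<open>The balance \<open>wp * x p + wq * x q = 0\<close> at \<open>r\<close> gives \<open>1 - x q / x p = (wp + wq) / wq\<close>, which times
  the series weight is \<open>wp\<close>; likewise for \<open>q\<close>.\<close>
lemma subdivide_along_contract: "subdivide_along H (restrict x (V - {r})) p r q = G"
proof -
  have wH: "wt H {p, q} = wp * wq / (wp + wq)" by (simp add: contract_simps)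
  have nz: "x p \<noteq> 0" "x q \<noteq> 0" using x_nonzero verts_pqr by auto
  have "wq * x q = - (wp * x p)" using balance by simp
  then have q: "x q / x p = - wp / wq" and p: "x p / x q = - wq / wp"
    using nz wp_pos wq_pos by (simp_all add: field_simps)
  have "1 - - wp / wq = (wp + wq) / wq" "1 - - wq / wp = (wp + wq) / wp"
    using wp_pos wq_pos by (simp_all add: add_divide_distrib)
  moreover have "wp + wq \<noteq> 0" using wp_pos wq_pos by simp
  ultimately have "wt H {p, q} * (1 - x q / x p) = wp" "wt H {p, q} * (1 - x p / x q) = wq"
    unfolding wH q p using wp_pos wq_pos by simp_all
  then show ?thesis
    using subdivide_contract[OF tree nbrs pq] verts_pqr by simp
qed

end

lemma subdivide_rename_iso:
  assumes G: "simple_graph G" and r: "r \<notin> verts G" and r': "r' \<notin> verts G"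
    and pq: "p \<in> verts G" "q \<in> verts G" and neq: "p \<noteq> q"
  shows "wgraph_iso (id(r := r')) (subdivide G p r q wp wq) (subdivide G p r' q wp wq)"
proof -
  let ?f = "id(r := r')" and ?K = "subdivide G p r q wp wq" and ?L = "subdivide G p r' q wp wq"
  have fix_edge: "?f ` e = e" if "e \<in> edges G" for e
  proof -
    have "e \<subseteq> verts G" using edge_pairE[OF G that] by blast
    then have "?f ` e = id ` e" using r by (intro image_cong) auto
    then show ?thesis by simp
  qed
  have new: "?f ` {p, r} = {p, r'}" "?f ` {q, r} = {q, r'}" using pq r by auto
  have notin: "{i, r'} \<notin> edges G" "{i, r} \<notin> edges G" for i
    using edge_endpoints(2)[OF G] r r' by blast+
  have "bij_betw ?f (insert r (verts G)) (insert r' (verts G))"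
    using r r' by (auto simp: bij_betw_def inj_on_def)
  moreover have "edges ?L = (`) ?f ` edges ?K"
  proof -
    have "(`) ?f ` (edges G - {{p, q}}) = (\<lambda>e. e) ` (edges G - {{p, q}})"
      by (intro image_cong refl) (use fix_edge in blast)
    moreover have "p \<noteq> r" "q \<noteq> r" using pq r by auto
    ultimately show ?thesis by (simp add: subdivide_simps(2) image_Un)
  qed
  moreover have "wt ?L (?f ` e) = wt ?K e" if e: "e \<in> edges ?K" for e
  proof (cases "e = {p, r} \<or> e = {q, r}")
    case True
    then show ?thesis using new wt_subdivide_new[OF neq] by metis
  next
    case False
    then have eG: "e \<in> edges G" "e \<noteq> {p, q}" using e by (auto simp: subdivide_simps)
    then have "e \<noteq> {p, r'}" "e \<noteq> {q, r'}" using notin by auto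
    then show ?thesis using False eG fix_edge by (simp add: subdivide_simps)
  qed
  ultimately show ?thesis unfolding wgraph_iso_def by (simp add: subdivide_simps(1))
qed

theorem theorem3p1:
  shows
    "(\<forall>G1 :: 'a wgraph. G1 \<in> T1_2 \<longrightarrow>
        (\<exists>!G2. char_contraction G1 G2) \<and>
        (\<forall>G2. char_contraction G1 G2 \<longrightarrow>
           G2 \<in> T2 \<and> algebraic_connectivity G2 = algebraic_connectivity G1))
   \<and> (\<forall>(G2 :: 'a wgraph) r. G2 \<in> T2 \<and> r \<notin> verts G2 \<longrightarrow>
        (\<exists>!G1. char_subdivision r G2 G1) \<and>
        (\<forall>G1. char_subdivision r G2 G1 \<longrightarrow>
           G1 \<in> T1_2 \<and> algebraic_connectivity G1 = algebraic_connectivity G2))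
   \<and> (\<forall>(G1 :: 'a wgraph) G2 r. char_contraction G1 G2 \<and> verts G1 - verts G2 = {r} \<longrightarrow>
        char_subdivision r G2 G1 \<and>
        (\<forall>r' G1'. char_subdivision r' G2 G1' \<longrightarrow> wgraph_iso (id(r := r')) G1 G1'))
   \<and> (\<forall>(G1 :: 'a wgraph) G2 r. char_subdivision r G2 G1 \<longrightarrow> char_contraction G1 G2)
   \<and> (\<forall>(G1 :: 'a wgraph) G2 r. char_contraction G1 G2 \<and> verts G1 - verts G2 = {r} \<longrightarrow>
        (\<forall>x1. fiedler_vector G1 x1 \<longrightarrow> fiedler_vector G2 (restrict x1 (verts G1 - {r}))) \<and>
        (\<forall>x2. fiedler_vector G2 x2 \<longrightarrow> fiedler_vector G1 (x2(r := 0))))"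
proof (intro conjI allI impI; (elim conjE)?)
  fix G1 :: "'a wgraph" assume "G1 \<in> T1_2"
  then obtain p r q x where v: "char_vertex G1 p r q x" by (rule T1_2E)
  show "\<exists>!G2. char_contraction G1 G2"
  proof (rule ex1I)
    show "char_contraction G1 (contract G1 p r q)" by (rule char_vertex.char_contraction[OF v])
    fix G2 assume "char_contraction G1 G2"
    then obtain p' r' q' x' where "char_vertex G1 p' r' q' x'" "G2 = contract G1 p' r' q'"
      by (rule char_contractionE)
    then show "G2 = contract G1 p r q" using char_vertex_unique(2)[OF v] by blast
  qed
next
  fix G1 G2 :: "'a wgraph" assume "char_contraction G1 G2"
  then obtain p r q x where v: "char_vertex G1 p r q x" "G2 = contract G1 p r q"
    by (rule char_contractionE)
  show "G2 \<in> T2" "algebraic_connectivity G2 = algebraic_connectivity G1"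
    using char_vertex.contract_T2[OF v(1)] char_vertex.connectivity_contract[OF v(1)] v(2) by simp_all
next
  fix G2 :: "'a wgraph" and r assume "G2 \<in> T2" and r: "r \<notin> verts G2"
  then obtain p q x where e: "char_edge G2 p q x" using type_II_char_edge by blast
  show "\<exists>!G1. char_subdivision r G2 G1"
  proof (rule ex1I)
    show "char_subdivision r G2 (subdivide_along G2 x p r q)"
      by (rule char_edge.char_subdivision[OF e r])
    fix G1 assume "char_subdivision r G2 G1"
    then obtain p' q' x' where "char_edge G2 p' q' x'" "G1 = subdivide_along G2 x' p' r q'"
      by (rule char_subdivisionE)
    then show "G1 = subdivide_along G2 x p r q" using char_edge_unique[OF e] by blast
  qed
next
  fix G1 G2 :: "'a wgraph" and r assume "char_subdivision r G2 G1"
  then obtain p q x where e: "char_edge G2 p q x" and r: "r \<notin> verts G2"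
    and G1: "G1 = subdivide_along G2 x p r q" by (rule char_subdivisionE)
  note v = char_edge.subdivide_along_char_vertex[OF e r, folded G1]
  show "G1 \<in> T1_2" by (rule char_vertex.in_T1_2[OF v(1)])
  show "algebraic_connectivity G1 = algebraic_connectivity G2"
    using char_vertex.connectivity_contract[OF v(1)] by (simp only: v(2))
  show "char_contraction G1 G2"
    using char_vertex.char_contraction[OF v(1)] by (simp only: v(2))
next
  \<comment> \<open>The characteristic vertex of \<open>G1\<close> is the one that the contraction removes, hence
    equal to the given \<open>r\<close>.\<close>
  fix G1 G2 :: "'a wgraph" and r
  assume con: "char_contraction G1 G2" and r: "verts G1 - verts G2 = {r}"
  obtain p q x where v: "char_vertex G1 p r q x" and G2: "G2 = contract G1 p r q"
  proof -
    obtain p s q x where v: "char_vertex G1 p s q x" "G2 = contract G1 p s q"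
      using con by (rule char_contractionE)
    interpret char_vertex G1 p s q x by (rule v(1))
    have "s = r" using r verts_pqr(3) unfolding v(2) verts_H by auto
    then show thesis using v that by blast
  qed
  interpret char_vertex G1 p r q x by (rule v)
  have r2: "r \<notin> verts G2" by (simp add: G2 verts_H)
  define y where "y = restrict x (V - {r})"
  have e: "char_edge G2 p q y" unfolding y_def G2 by (rule char_edge_contract)
  have G1: "G1 = subdivide_along G2 y p r q" unfolding y_def G2 by (rule subdivide_along_contract[symmetric])
  show "char_subdivision r G2 G1" using char_edge.char_subdivision[OF e r2] G1 by simp
  show "wgraph_iso (id(r := r')) G1 G1'" if sub: "char_subdivision r' G2 G1'" for r' G1'
  proof -
    obtain p' q' x' where e': "char_edge G2 p' q' x'" and r': "r' \<notin> verts G2"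
      and "G1' = subdivide_along G2 x' p' r' q'" using sub by (rule char_subdivisionE)
    then have G1': "G1' = subdivide_along G2 y p r' q" using char_edge_unique[OF e e'] by simp
    interpret E: char_edge G2 p q y by (rule e)
    show ?thesis unfolding G1' by (subst G1) (rule subdivide_rename_iso[OF E.simple r2 r' E.verts_pq pq])
  qed
  show "fiedler_vector G2 (restrict x1 (verts G1 - {r}))" if "fiedler_vector G1 x1" for x1
    unfolding G2 using that by (rule fiedler_restrict)
  show "fiedler_vector G1 (x2(r := 0))" if "fiedler_vector G2 x2" for x2
    using that unfolding G2 by (rule fiedler_extend)
qed

end
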